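(* There is an FPTAS for $Z(G)$ on graphs $G$ in which every vertex of degree at least $6$ has 2-degree at most $26$.
   Context: $Z(G)$ is the number of independent sets of the graph $G$. The 2-degree of a vertex $v$ is the sum of the degrees of the neighbours of $v$. An FPTAS is an algorithm that, given $G$ and a rational $\varepsilon\in(0,1)$, outputs a number $N$ with $(1-\varepsilon)Z(G)\le N\le(1+\varepsilon)Z(G)$ in time polynomial in $|V(G)|$ and $1/\varepsilon$. *)

theory Defs
  imports Complex_Main "HOL-Library.Log_Nat"
begin

section \<open>Graphs and independent sets\<close>

record 'a graph =
  verts :: "'a set"
  edges :: "'a set set"

definition simple_graph :: "'a graph \<Rightarrow> bool" where
  "simple_graph G \<longleftrightarrow>
     finite (verts G) \<and> (\<forall>e\<in>edges G. e \<subseteq> verts G \<and> card e = 2)"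

definition neighbours :: "'a graph \<Rightarrow> 'a \<Rightarrow> 'a set" where
  "neighbours G v = {w. {v, w} \<in> edges G}"

definition degree :: "'a graph \<Rightarrow> 'a \<Rightarrow> nat" where
  "degree G v = card (neighbours G v)"

definition two_degree :: "'a graph \<Rightarrow> 'a \<Rightarrow> nat" where
  "two_degree G v = (\<Sum>w\<in>neighbours G v. degree G w)"

definition independent_set :: "'a graph \<Rightarrow> 'a set \<Rightarrow> bool" where
  "independent_set G I \<longleftrightarrow> I \<subseteq> verts G \<and> (\<forall>e\<in>edges G. \<not> e \<subseteq> I)"

definition Z :: "'a graph \<Rightarrow> nat" where
  "Z G = card {I. independent_set G I}"

section \<open>Model of computation\<close>

text \<open>
  Algorithms are programs of a first-order, call-by-value functional language with general
  recursion. Its values are binary trees with natural numbers at the leaves. A step of the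
  evaluation costs one time unit, except that an arithmetic operation costs in addition the
  binary lengths of its operands. An implementation that keeps values as pointers to shared
  trees and numbers in binary shows that, up to a polynomial, this is the time of a
  multitape Turing machine: a step builds at most one new tree node, and numbers cannot
  outgrow the time spent on computing them.
\<close>

datatype val = Num nat | VPair val val

datatype arith_op = Add | Sub | Mul | Div | Less

datatype expr =
    Var nat
  | Const nat
  | Arith arith_op expr expr
  | MkPair expr expr
  | First expr
  | Second expr
  | Cond expr expr expr
  | Bind expr expr
  | Call nat "expr list"

definition num_size :: "nat \<Rightarrow> nat" where
  "num_size m = nat (bitlen (int m))"

fun apply_op :: "arith_op \<Rightarrow> nat \<Rightarrow> nat \<Rightarrow> nat" where
  "apply_op Add m n = m + n"
| "apply_op Sub m n = m - n"
| "apply_op Mul m n = m * n"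
| "apply_op Div m n = m div n"
| "apply_op Less m n = (if m < n then 1 else 0)"

text \<open>
  \<open>eval F env e v t\<close>: with the function bodies \<open>F\<close> and the variables bound by \<open>env\<close> (de Bruijn
  indices), \<open>e\<close> evaluates to \<open>v\<close> in time \<open>t\<close>. The condition of a \<open>Cond\<close> fails exactly on
  \<open>Num 0\<close>, which also represents the empty list. An ill-formed expression (unbound variable,
  undefined function, arithmetic on a pair, projection of a number) has no value.
\<close>

inductive eval :: "expr list \<Rightarrow> val list \<Rightarrow> expr \<Rightarrow> val \<Rightarrow> nat \<Rightarrow> bool"
  and evals :: "expr list \<Rightarrow> val list \<Rightarrow> expr list \<Rightarrow> val list \<Rightarrow> nat \<Rightarrow> bool"
  for F :: "expr list"
where
  Var: "i < length env \<Longrightarrow> eval F env (Var i) (env ! i) 1"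
| Const: "eval F env (Const m) (Num m) 1"
| Arith: "eval F env e\<^sub>1 (Num m) t\<^sub>1 \<Longrightarrow> eval F env e\<^sub>2 (Num n) t\<^sub>2 \<Longrightarrow>
    eval F env (Arith f e\<^sub>1 e\<^sub>2) (Num (apply_op f m n)) (t\<^sub>1 + t\<^sub>2 + num_size m + num_size n + 1)"
| MkPair: "eval F env e\<^sub>1 v\<^sub>1 t\<^sub>1 \<Longrightarrow> eval F env e\<^sub>2 v\<^sub>2 t\<^sub>2 \<Longrightarrow>
    eval F env (MkPair e\<^sub>1 e\<^sub>2) (VPair v\<^sub>1 v\<^sub>2) (t\<^sub>1 + t\<^sub>2 + 1)"
| First: "eval F env e (VPair v\<^sub>1 v\<^sub>2) t \<Longrightarrow> eval F env (First e) v\<^sub>1 (t + 1)"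
| Second: "eval F env e (VPair v\<^sub>1 v\<^sub>2) t \<Longrightarrow> eval F env (Second e) v\<^sub>2 (t + 1)"
| Cond_true: "eval F env b u t\<^sub>1 \<Longrightarrow> u \<noteq> Num 0 \<Longrightarrow> eval F env e\<^sub>1 v t\<^sub>2 \<Longrightarrow>
    eval F env (Cond b e\<^sub>1 e\<^sub>2) v (t\<^sub>1 + t\<^sub>2 + 1)"
| Cond_false: "eval F env b (Num 0) t\<^sub>1 \<Longrightarrow> eval F env e\<^sub>2 v t\<^sub>2 \<Longrightarrow>
    eval F env (Cond b e\<^sub>1 e\<^sub>2) v (t\<^sub>1 + t\<^sub>2 + 1)"
| Bind: "eval F env e\<^sub>1 u t\<^sub>1 \<Longrightarrow> eval F (u # env) e\<^sub>2 v t\<^sub>2 \<Longrightarrow>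
    eval F env (Bind e\<^sub>1 e\<^sub>2) v (t\<^sub>1 + t\<^sub>2 + 1)"
| Call: "evals F env es us t\<^sub>1 \<Longrightarrow> f < length F \<Longrightarrow> eval F us (F ! f) v t\<^sub>2 \<Longrightarrow>
    eval F env (Call f es) v (t\<^sub>1 + t\<^sub>2 + 1)"
| Args_Nil: "evals F env [] [] 0"
| Args_Cons: "eval F env e v t\<^sub>1 \<Longrightarrow> evals F env es vs t\<^sub>2 \<Longrightarrow>
    evals F env (e # es) (v # vs) (t\<^sub>1 + t\<^sub>2)"

inductive_cases eval_cases:
  "eval F env (Var i) v t" "eval F env (Const m) v t" "eval F env (Arith f e\<^sub>1 e\<^sub>2) v t"
  "eval F env (MkPair e\<^sub>1 e\<^sub>2) v t" "eval F env (First e) v t" "eval F env (Second e) v t"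
  "eval F env (Cond b e\<^sub>1 e\<^sub>2) v t" "eval F env (Bind e\<^sub>1 e\<^sub>2) v t" "eval F env (Call f es) v t"
  "evals F env [] vs t" "evals F env (e # es) vs t"

lemma eval_deterministic:
  "eval F env e v t \<Longrightarrow> eval F env e v' t' \<Longrightarrow> v' = v \<and> t' = t"
  "evals F env es vs t \<Longrightarrow> evals F env es vs' t' \<Longrightarrow> vs' = vs \<and> t' = t"
proof (induction arbitrary: v' t' and vs' t' rule: eval_evals.inducts)
  case (Var i env)
  then show ?case by (auto elim: eval_cases(1))
next
  case (Const env m)
  then show ?case by (auto elim: eval_cases(2))
next
  case (Arith env e\<^sub>1 m t\<^sub>1 e\<^sub>2 n t\<^sub>2 f)
  from Arith.prems show ?case
    by (rule eval_cases(3)) (auto dest!: Arith.IH(2,4))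
next
  case (MkPair env e\<^sub>1 v\<^sub>1 t\<^sub>1 e\<^sub>2 v\<^sub>2 t\<^sub>2)
  from MkPair.prems show ?case
    by (rule eval_cases(4)) (auto dest!: MkPair.IH(2,4))
next
  case (First env e v\<^sub>1 v\<^sub>2 t)
  from First.prems show ?case
    by (rule eval_cases(5)) (auto dest!: First.IH(2))
next
  case (Second env e v\<^sub>1 v\<^sub>2 t)
  from Second.prems show ?case
    by (rule eval_cases(6)) (auto dest!: Second.IH(2))
next
  case (Cond_true env b u t\<^sub>1 e\<^sub>1 v t\<^sub>2 e\<^sub>2)
  from Cond_true.prems show ?case
    by (rule eval_cases(7)) (auto simp: Cond_true.hyps dest!: Cond_true.IH(2,4))
next
  case (Cond_false env b t\<^sub>1 e\<^sub>2 v t\<^sub>2 e\<^sub>1)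
  from Cond_false.prems show ?case
    by (rule eval_cases(7)) (auto dest!: Cond_false.IH(2,4))
next
  case (Bind env e\<^sub>1 u t\<^sub>1 e\<^sub>2 v t\<^sub>2)
  from Bind.prems show ?case
    by (rule eval_cases(8)) (auto dest!: Bind.IH(2,4))
next
  case (Call env es us t\<^sub>1 f v t\<^sub>2)
  from Call.prems show ?case
    by (rule eval_cases(9)) (auto dest!: Call.IH(2,5))
next
  case (Args_Nil env)
  then show ?case by (auto elim: eval_cases(10))
next
  case (Args_Cons env e v t\<^sub>1 es vs t\<^sub>2)
  from Args_Cons.prems show ?case
    by (rule eval_cases(11)) (auto dest!: Args_Cons.IH(2,4))
qed

section \<open>Encodings and approximation schemes\<close>

fun list_val :: "val list \<Rightarrow> val" where
  "list_val [] = Num 0"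
| "list_val (x # xs) = VPair x (list_val xs)"

text \<open>
  The input graphs have the vertices \<open>0, \<dots>, n - 1\<close>, which covers all finite simple graphs up to
  isomorphism. They are given by their adjacency lists.
\<close>

definition graph_val :: "nat graph \<Rightarrow> val" where
  "graph_val G =
     list_val (map (\<lambda>v. list_val (map Num (sorted_list_of_set (neighbours G v))))
       [0..<card (verts G)])"

text \<open>
  A positive rational number \<open>p / q < 1\<close> in lowest terms is given by the binary digits of
  \<open>p\<close> and \<open>q\<close>, written in parallel from the leading digit of \<open>q\<close> downwards. The running time is
  to be polynomial in the value \<open>q / p\<close> and is not allowed to depend on the length of \<open>q\<close>,
  so a program must be able to estimate \<open>p / q\<close> without reading all digits.
\<close>

definition rat_val :: "rat \<Rightarrow> val" where
  "rat_val x = (case quotient_of x of (p, q) \<Rightarrow>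
     list_val (map (\<lambda>i. VPair (Num (of_bool (bit p i))) (Num (of_bool (bit q i))))
       (rev [0..<nat (bitlen q)])))"

text \<open>
  The output is a fraction \<open>a / b\<close>. Since \<open>1 / \<epsilon> > 1\<close>, a time bound of the form
  \<open>c * (n + 1 / \<epsilon>) ^ k\<close> is the same as a polynomial bound in \<open>n\<close> and \<open>1 / \<epsilon>\<close>.
\<close>

definition has_fptas :: "(nat graph \<Rightarrow> nat) \<Rightarrow> nat graph set \<Rightarrow> bool" where
  "has_fptas f C \<longleftrightarrow>
     (\<exists>(F :: expr list) (main :: expr) (c :: nat) (k :: nat).
        \<forall>G \<in> C. \<forall>\<epsilon> :: rat.
          simple_graph G \<and> verts G = {..<card (verts G)} \<and> 0 < \<epsilon> \<and> \<epsilon> < 1 \<longrightarrow>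
          (\<exists>a b t. eval F [graph_val G, rat_val \<epsilon>] main (VPair (Num a) (Num b)) t \<and>
             0 < b \<and>
             (1 - \<epsilon>) * of_nat (f G) \<le> of_nat a / of_nat b \<and>
             of_nat a / of_nat b \<le> (1 + \<epsilon>) * of_nat (f G) \<and>
             of_nat t \<le> of_nat c * (of_nat (card (verts G)) + 1 / \<epsilon>) ^ k))"

end

theory Submission
  imports Defs "HOL-Analysis.Convex"
begin

text \<open>
  Removing the vertices of \<open>G\<close> one by one writes \<open>1 / Z G\<close> as a product of factors \<open>1 / (1 + R)\<close>,
  where \<open>R\<close> is the ratio of the numbers of independent sets with and without a vertex \<open>v\<close> of an
  induced subgraph. In turn, \<open>R\<close> is a product of factors \<open>1 / (1 + R')\<close>, one for each neighbour of \<open>v\<close>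
  that is still present (Weitz). The algorithm runs this recursion to a depth logarithmic
  in \<open>n / \<epsilon>\<close> with exact fractions; all degrees are at most 26, so this takes polynomial time.

  In the coordinate \<open>y = arsinh (sqrt R)\<close> (Sinclair, Srivastava, Stefankovic, Yin) the
  squared error at a vertex with \<open>d\<close> children is at most \<open>\<alpha> d\<close> times the sum of the squared errors at the
  children. Since \<open>4 * \<alpha> 4 < 1\<close>, this contracts as long as there are at most four children. A vertex
  with five or more children has degree at least 6, and the bound 26 on its 2-degree limits the number
  of its grandchildren. Weighting the squared error at a vertex by its number of children therefore
  gives a uniform decay.
\<close>

section \<open>The contraction estimate\<close>

text \<open>Each factor satisfies \<open>y i \<le> c * exp (y i / c - 1)\<close>, by the tangent
  line of exp at 0. With \<open>c\<close> chosen as a mean this becomes the inequality of arithmetic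
  and geometric means.\<close>

lemma prod_le_exp_sum:
  fixes y :: "'i \<Rightarrow> real"
  assumes "finite I" "\<And>i. i \<in> I \<Longrightarrow> 0 \<le> y i" "c > 0"
  shows "prod y I \<le> c ^ card I * exp (sum y I / c - card I)"
proof -
  have "prod y I \<le> (\<Prod>i\<in>I. c * exp (y i / c - 1))"
  proof (rule prod_mono, safe)
    fix i assume "i \<in> I"
    show "y i \<le> c * exp (y i / c - 1)"
      using exp_ge_add_one_self[of "y i / c - 1"] \<open>c > 0\<close> by (simp add: field_simps)
  qed (use assms in auto)
  also have "\<dots> = c ^ card I * exp (\<Sum>i\<in>I. y i / c - 1)"
    by (simp add: prod.distrib exp_sum assms)
  also have "(\<Sum>i\<in>I. y i / c - 1) = sum y I / c - card I"
    by (simp add: sum_subtractf sum_divide_distrib)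
  finally show ?thesis .
qed

text \<open>
  The last condition is what the inequality of arithmetic and geometric means yields for the
  \<open>d + 1\<close> numbers \<open>y\<^sub>1, \<dots>, y\<^sub>d\<close> and \<open>d - \<alpha> - (y\<^sub>1 + \<dots> + y\<^sub>d)\<close>, where \<open>1 - y\<^sub>i\<close> are the occupation
  probabilities of the children.
\<close>

definition contraction_rate :: "nat \<Rightarrow> real \<Rightarrow> bool" where
  "contraction_rate d \<alpha> \<longleftrightarrow> 0 < \<alpha> \<and> \<alpha> < 1 \<and> ((real d - \<alpha>) / (real d + 1)) ^ (d + 1) \<le> \<alpha>"

lemma contraction_rate_occupation:
  fixes y :: "'i \<Rightarrow> real"
  assumes "finite I" "\<And>i. i \<in> I \<Longrightarrow> 0 \<le> y i" "contraction_rate (card I) \<alpha>"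
  shows "prod y I * (\<Sum>i\<in>I. 1 - y i) \<le> \<alpha> * (1 + prod y I)"
proof (cases "card I = 0")
  case True
  then have "I = {}" using assms by simp
  then show ?thesis using assms(3) by (simp add: contraction_rate_def)
next
  case False
  \<comment> \<open>\<open>z\<close> completes the \<open>y i\<close> to \<open>d + 1\<close>
    numbers with sum \<open>d - \<alpha>\<close>, and \<open>c\<close> is their mean, so the
    exponents cancel below. The claim is equivalent to
    \<open>prod y I * z \<le> \<alpha>\<close>.\<close>
  define d c z where "d = card I" and "c = (real d - \<alpha>) / (real d + 1)"
    and "z = real d - \<alpha> - sum y I"
  have \<alpha>: "0 < \<alpha>" "\<alpha> < 1" "c ^ (d + 1) \<le> \<alpha>"
    using assms(3) by (simp_all add: contraction_rate_def c_def d_def)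
  have d: "real d \<ge> 1" using False d_def by linarith
  then have c: "c > 0" using \<alpha> by (simp add: c_def)
  have P: "prod y I \<ge> 0" using assms by (simp add: prod_nonneg)
  have "prod y I * z \<le> \<alpha>"
  proof (cases "z \<le> 0")
    case True
    then show ?thesis using P \<alpha> mult_nonneg_nonpos[OF P True] by linarith
  next
    case False
    have "z \<le> c * exp (z / c - 1)"
      using exp_ge_add_one_self[of "z / c - 1"] \<open>c > 0\<close> by (simp add: field_simps)
    then have "prod y I * z \<le> (c ^ d * exp (sum y I / c - d)) * (c * exp (z / c - 1))"
      using prod_le_exp_sum[OF assms(1,2) c] P False c by (intro mult_mono) (auto simp: d_def)
    also have "\<dots> = c ^ (d + 1) * exp ((sum y I + z) / c - (d + 1))"
      by (simp add: exp_add[symmetric] add_divide_distrib algebra_simps)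
    also have "(sum y I + z) / c - (d + 1) = 0"
    proof -
      have "sum y I + z = c * (real d + 1)" using d by (simp add: z_def c_def)
      then show ?thesis using c by simp
    qed
    finally show ?thesis using \<alpha> by simp
  qed
  moreover have "(\<Sum>i\<in>I. 1 - y i) = z + \<alpha>" by (simp add: z_def d_def sum_subtractf)
  ultimately show ?thesis by (simp add: algebra_simps)
qed

text \<open>
  The partial derivatives of the map are \<open>- tanh y * tanh (u i)\<close> with \<open>y\<close> the value of the map, and
  the squares of these hyperbolic tangents are occupation probabilities.
\<close>

lemma arsinh_prod_contraction:
  fixes u v :: "'i \<Rightarrow> real"
  assumes I: "finite I" and \<alpha>: "contraction_rate (card I) \<alpha>"
  shows "(arsinh (\<Prod>i\<in>I. 1 / cosh (u i)) - arsinh (\<Prod>i\<in>I. 1 / cosh (v i)))\<^sup>2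
    \<le> \<alpha> * (\<Sum>i\<in>I. (u i - v i)\<^sup>2)"
proof -
  \<comment> \<open>The segment from \<open>v\<close> to \<open>u\<close>. By the mean value theorem
    it suffices to bound the derivative along it, and Cauchy-Schwarz splits that into the norm of
    the gradient and the distance of the end points.\<close>
  define x where "x i t = v i + t * (u i - v i)" for i t
  define g where "g t = - (\<Sum>i\<in>I. ln (cosh (x i t)))" for t
  define g' where "g' t = - (\<Sum>i\<in>I. tanh (x i t) * (u i - v i))" for t
  define f where "f t = arsinh (exp (g t))" for t
  define f' where "f' t = exp (g t) / sqrt ((exp (g t))\<^sup>2 + 1) * g' t" for t
  have E: "exp (g t) = (\<Prod>i\<in>I. 1 / cosh (x i t))" for t
    by (simp add: g_def exp_minus exp_sum I prod_dividef inverse_eq_divide)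
  have "(g has_real_derivative g' t) (at t)" for t
    unfolding g_def g'_def x_def
    by (auto intro!: derivative_eq_intros sum.cong simp: tanh_def)
  then have "((\<lambda>t. exp (g t)) has_real_derivative exp (g t) * g' t) (at t)" for t
    by (rule DERIV_fun_exp)
  from DERIV_chain2[OF arsinh_real_has_field_derivative this]
  have D: "(f has_real_derivative f' t) (at t)" for t
    unfolding f_def f'_def by simp
  have bound: "(f' t)\<^sup>2 \<le> \<alpha> * (\<Sum>i\<in>I. (u i - v i)\<^sup>2)" for t
  proof -
    define y where "y i = 1 / (cosh (x i t))\<^sup>2" for i
    have y: "prod y I = (exp (g t))\<^sup>2" by (simp add: y_def E prod_power_distrib power_divide prod_dividef)
    have th: "(tanh (x i t))\<^sup>2 = 1 - y i" for i
    proof -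
      have "(sinh (x i t))\<^sup>2 = (cosh (x i t))\<^sup>2 - 1" by (simp add: cosh_square_eq)
      then show ?thesis by (simp add: y_def tanh_def power_divide diff_divide_distrib)
    qed
    have "(g' t)\<^sup>2 \<le> (\<Sum>i\<in>I. (tanh (x i t))\<^sup>2) * (\<Sum>i\<in>I. (u i - v i)\<^sup>2)"
      unfolding g'_def power2_minus by (rule Cauchy_Schwarz_ineq_sum)
    then have "(f' t)\<^sup>2 \<le> (exp (g t))\<^sup>2 / ((exp (g t))\<^sup>2 + 1) * ((\<Sum>i\<in>I. 1 - y i) * (\<Sum>i\<in>I. (u i - v i)\<^sup>2))"
      by (simp add: f'_def power_mult_distrib power_divide th divide_right_mono mult_left_mono)
    also have "\<dots> = (prod y I * (\<Sum>i\<in>I. 1 - y i)) / (1 + prod y I) * (\<Sum>i\<in>I. (u i - v i)\<^sup>2)"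
      by (simp add: y algebra_simps)
    also have "\<dots> \<le> \<alpha> * (\<Sum>i\<in>I. (u i - v i)\<^sup>2)"
    proof (rule mult_right_mono)
      have "prod y I \<ge> 0" by (simp add: y)
      then show "(prod y I * (\<Sum>i\<in>I. 1 - y i)) / (1 + prod y I) \<le> \<alpha>"
        using contraction_rate_occupation[OF I _ \<alpha>, of y]
        by (simp add: field_simps y_def)
    qed (simp add: sum_nonneg)
    finally show ?thesis .
  qed
  obtain t where "f 1 - f 0 = (1 - 0) * f' t"
    using MVT2[of 0 1 f f'] D by auto
  then have "(f 1 - f 0)\<^sup>2 \<le> \<alpha> * (\<Sum>i\<in>I. (u i - v i)\<^sup>2)" using bound[of t] by simp
  then show ?thesis by (simp add: f_def E x_def)
qed

lemma contraction_rate_1: "contraction_rate 1 (1/5)"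
  and contraction_rate_2: "contraction_rate 2 (43/200)"
  and contraction_rate_3: "contraction_rate 3 (23/100)"
  and contraction_rate_4: "contraction_rate 4 (121/500)"
  and contraction_rate_5: "contraction_rate 5 (249/1000)"
  and contraction_rate_6: "contraction_rate 6 (51/200)"
  and contraction_rate_7: "contraction_rate 7 (27/100)"
  by (simp_all add: contraction_rate_def power_divide)

text \<open>The base is \<open>1 - (1 + \<alpha>) / (d + 1)\<close>, so the power is at most
  \<open>exp (- (1 + \<alpha>))\<close> for every \<open>d\<close>. Here \<open>1 + \<alpha>\<close>
  is 129/100.\<close>

lemma contraction_rate_large:
  assumes "d \<ge> 1"
  shows "contraction_rate d (29/100)"
proof -
  have "((real d - 29/100) / (real d + 1)) ^ (d + 1) = (1 - (129/100) / (real d + 1)) ^ (d + 1)"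
    by (simp add: field_simps)
  also have "\<dots> \<le> exp (- (129/100) / (real d + 1)) ^ (d + 1)"
    using assms exp_ge_add_one_self[of "- (129/100) / (real d + 1)"]
    by (intro power_mono) (auto simp: field_simps)
  also have "\<dots> = exp (- (129/100))"
    by (subst exp_of_nat_mult[symmetric]) (simp add: field_simps)
  also have "\<dots> \<le> 29/100"
  proof -
    \<comment> \<open>Splitting the exponent into 16 equal parts gives a rational lower bound for
      \<open>exp (129/100)\<close> that is just sharp enough to exceed 100/29.\<close>
    have "(1 + 129/1600) ^ 16 \<le> exp (129/1600 :: real) ^ 16"
      by (intro power_mono) (use exp_ge_add_one_self[of "129/1600"] in auto)
    also have "\<dots> = exp (129/100)" by (subst exp_of_nat_mult[symmetric]) simp
    finally have "100/29 \<le> exp (129/100 :: real)" by (simp add: power_divide)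
    then show ?thesis by (simp add: exp_minus field_simps)
  qed
  finally show ?thesis by (simp add: contraction_rate_def)
qed

section \<open>Independent sets and the recursion\<close>

text \<open>Counts in the subgraph induced by \<open>A\<close> while \<open>G\<close> itself, and
  with it adjacency and degrees, stays fixed.\<close>

definition Z_on :: "'a graph \<Rightarrow> 'a set \<Rightarrow> nat" where
  "Z_on G A = card {I. I \<subseteq> A \<and> independent_set G I}"

lemma Z_on_verts: "Z_on G (verts G) = Z G"
  unfolding Z_on_def Z_def by (rule arg_cong[where f = card]) (auto simp: independent_set_def)

lemma neighbours_sym: "w \<in> neighbours G v \<longleftrightarrow> v \<in> neighbours G w"
  by (simp add: neighbours_def insert_commute)

context
  fixes G :: "'a graph"
  assumes G: "simple_graph G"
begin

lemma neighbours_subset: "neighbours G v \<subseteq> verts G - {v}"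
  using G by (force simp: simple_graph_def neighbours_def)

lemma finite_neighbours: "finite (neighbours G v)"
  using neighbours_subset G by (meson finite_Diff finite_subset simple_graph_def)

lemma degree_pos: "w \<in> neighbours G v \<Longrightarrow> 0 < degree G w"
  using finite_neighbours by (auto simp: degree_def card_gt_0_iff neighbours_sym[of w])

lemma empty_independent: "independent_set G {}"
  using G by (auto simp: independent_set_def simple_graph_def)

lemma finite_independent_sets: "finite {I. I \<subseteq> A \<and> independent_set G I}"
proof (rule finite_subset)
  show "{I. I \<subseteq> A \<and> independent_set G I} \<subseteq> Pow (verts G)" by (auto simp: independent_set_def)
  show "finite (Pow (verts G))" using G by (simp add: simple_graph_def)
qed

lemma Z_on_pos: "0 < Z_on G A"
  using finite_independent_sets[of A] empty_independent
  by (auto simp: Z_on_def card_gt_0_iff)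

lemma Z_on_empty: "Z_on G {} = 1"
proof -
  have "{I. I \<subseteq> {} \<and> independent_set G I} = {{}}" using empty_independent by auto
  then show ?thesis by (simp add: Z_on_def)
qed

lemma independent_insert:
  assumes "v \<in> verts G" "v \<notin> I"
  shows "independent_set G (insert v I) \<longleftrightarrow> independent_set G I \<and> I \<inter> neighbours G v = {}"
proof -
  have "(\<forall>e\<in>edges G. \<not> e \<subseteq> insert v I) \<longleftrightarrow> (\<forall>e\<in>edges G. \<not> e \<subseteq> I) \<and> I \<inter> neighbours G v = {}"
    (is "?L \<longleftrightarrow> ?R")
  proof
    assume L: ?L
    have "w \<notin> I" if "w \<in> neighbours G v" for w
    proof -
      have "{v, w} \<in> edges G" using that by (simp add: neighbours_def)
      then have "\<not> {v, w} \<subseteq> insert v I" by (rule bspec[OF L])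
      then show ?thesis by simp
    qed
    moreover have "\<not> e \<subseteq> I" if "e \<in> edges G" for e
      using bspec[OF L that] by (rule contrapos_nn) (rule subset_insertI2)
    ultimately show ?R by blast
  next
    assume R: ?R
    show ?L
    proof (intro ballI notI)
      fix e assume e: "e \<in> edges G" "e \<subseteq> insert v I"
      have "card e = 2" using G e(1) by (simp add: simple_graph_def)
      moreover have "v \<in> e" using R e by (metis subset_insert)
      ultimately obtain w where w: "e = {v, w}" "w \<noteq> v"
        by (auto simp: card_2_iff)
      then have "w \<in> I" "w \<in> neighbours G v" using e by (simp_all add: neighbours_def)
      then show False using R by blast
    qed
  qed
  then show ?thesis using assms by (simp add: independent_set_def)
qed

text \<open>Independent sets avoiding \<open>v\<close> give the first summand. Deleting
  \<open>v\<close> from those containing it is a bijection onto the sets counted by the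
  second.\<close>

lemma Z_on_remove:
  assumes v: "v \<in> verts G" "v \<in> A"
  shows "Z_on G A = Z_on G (A - {v}) + Z_on G (A - {v} - neighbours G v)"
proof -
  let ?S = "\<lambda>A. {I. I \<subseteq> A \<and> independent_set G I}"
  have split: "?S A = ?S (A - {v}) \<union> insert v ` ?S (A - {v} - neighbours G v)"
  proof (rule set_eqI)
    fix I
    show "I \<in> ?S A \<longleftrightarrow> I \<in> ?S (A - {v}) \<union> insert v ` ?S (A - {v} - neighbours G v)"
    proof (cases "v \<in> I")
      case False
      then show ?thesis by auto
    next
      case True
      then have I: "I = insert v (I - {v})" by auto
      have "I \<in> ?S A \<longleftrightarrow> I - {v} \<in> ?S (A - {v} - neighbours G v)"
        by (subst I, use independent_insert[of v "I - {v}"] v True in auto)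
      also have "\<dots> \<longleftrightarrow> I \<in> insert v ` ?S (A - {v} - neighbours G v)"
      proof
        assume "I - {v} \<in> ?S (A - {v} - neighbours G v)"
        then show "I \<in> insert v ` ?S (A - {v} - neighbours G v)" using I by (rule rev_image_eqI)
      next
        assume "I \<in> insert v ` ?S (A - {v} - neighbours G v)"
        then obtain J where J: "J \<in> ?S (A - {v} - neighbours G v)" "I = insert v J" by (rule imageE)
        then have "v \<notin> J" by blast
        then show "I - {v} \<in> ?S (A - {v} - neighbours G v)" using J by simp
      qed
      finally show ?thesis using True by auto
    qed
  qed
  have "inj_on (insert v) (?S (A - {v} - neighbours G v))"
  proof (rule inj_onI)
    fix I J
    assume "I \<in> ?S (A - {v} - neighbours G v)" "J \<in> ?S (A - {v} - neighbours G v)" "insert v I = insert v J"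
    moreover from this have "v \<notin> I" "v \<notin> J" by blast+
    ultimately show "I = J" by (simp add: insert_ident)
  qed
  then have "card (insert v ` ?S (A - {v} - neighbours G v)) = Z_on G (A - {v} - neighbours G v)"
    unfolding Z_on_def by (rule card_image)
  moreover have "?S (A - {v}) \<inter> insert v ` ?S (A - {v} - neighbours G v) = {}" by auto
  ultimately show ?thesis
    unfolding Z_on_def by (subst split, subst card_Un_disjoint) (auto simp: finite_independent_sets)
qed

end

text \<open>
  The pairs \<open>(D', w)\<close> list the vertices \<open>w\<close> that are really removed when those of a list are removed
  one after the other, each with the set \<open>D'\<close> of vertices that are already gone at that moment.
\<close>

fun removal_steps :: "'a set \<Rightarrow> 'a list \<Rightarrow> ('a set \<times> 'a) list" where
  "removal_steps D [] = []"
| "removal_steps D (w # ws) =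
     (if w \<in> D then removal_steps D ws else (D, w) # removal_steps (insert w D) ws)"

lemma removal_steps_memD:
  "(D', w) \<in> set (removal_steps D ws) \<Longrightarrow> D \<subseteq> D' \<and> D' \<subseteq> D \<union> set ws \<and> w \<in> set ws \<and> w \<notin> D'"
proof (induction ws arbitrary: D)
  case (Cons a ws)
  show ?case
  proof (cases "(D', w) = (D, a) \<and> a \<notin> D")
    case False
    then have "(D', w) \<in> set (removal_steps (insert a D) ws)"
      using Cons.prems by (auto split: if_splits simp: insert_absorb)
    from Cons.IH[OF this] show ?thesis by auto
  qed auto
qed simp

text \<open>Lets sums and cardinalities over removal steps be computed over vertices. Repetitions in
  the list are harmless, since a later occurrence finds its vertex already removed.\<close>

lemma bij_betw_snd_removal_steps: "bij_betw snd (set (removal_steps D ws)) (set ws - D)"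
proof (induction ws arbitrary: D)
  case (Cons a ws)
  show ?case
  proof (cases "a \<in> D")
    case True
    then have "set (a # ws) - D = set ws - D" by auto
    then show ?thesis using True Cons.IH[of D] by (simp only: removal_steps.simps if_True)
  next
    case False
    have "bij_betw snd (insert (D, a) (set (removal_steps (insert a D) ws)))
      (insert (snd (D, a)) (set ws - insert a D))"
      using notIn_Un_bij_betw[OF _ _ Cons.IH[of "insert a D"], of "(D, a)"]
      by (auto dest: removal_steps_memD)
    moreover have "insert (snd (D, a)) (set ws - insert a D) = set (a # ws) - D" using False by auto
    ultimately show ?thesis using False by (simp only: removal_steps.simps if_False list.set)
  qed
qed (simp add: bij_betw_def)

section \<open>The hyperbolic coordinate for ratios\<close>

definition angle :: "real \<Rightarrow> real" where
  "angle r = arsinh (sqrt r)"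

lemma cosh_angle: "0 \<le> r \<Longrightarrow> (cosh (angle r))\<^sup>2 = 1 + r"
  by (simp add: angle_def cosh_square_eq)

text \<open>In this coordinate the squared cosh is \<open>1 + r\<close>, so the square root of the
  product recursion is exactly the map treated in \<open>arsinh_prod_contraction\<close>.\<close>

lemma angle_prod:
  assumes "\<And>i. i \<in> I \<Longrightarrow> 0 \<le> r i"
  shows "angle (\<Prod>i\<in>I. 1 / (1 + r i)) = arsinh (\<Prod>i\<in>I. 1 / cosh (angle (r i)))"
proof -
  have "1 / cosh (angle (r i)) = sqrt (1 / (1 + r i))" if "i \<in> I" for i
    using assms[OF that] by (simp add: cosh_angle[symmetric] real_sqrt_divide)
  then have "(\<Prod>i\<in>I. 1 / cosh (angle (r i))) = (\<Prod>i\<in>I. sqrt (1 / (1 + r i)))"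
    by (rule prod.cong[OF refl])
  also have "\<dots> = sqrt (\<Prod>i\<in>I. 1 / (1 + r i))"
    by (induction I rule: infinite_finite_induct) (simp_all add: real_sqrt_mult real_sqrt_divide)
  finally show ?thesis by (simp add: angle_def)
qed

lemma angle_bounds:
  assumes "0 \<le> r" "r \<le> 1"
  shows "0 \<le> angle r" "angle r \<le> sqrt 2"
proof -
  show "0 \<le> angle r" using assms by (simp add: angle_def not_less[symmetric])
  have "angle r \<le> arsinh 1" using assms by (simp add: angle_def not_less[symmetric])
  also have "\<dots> = ln (1 + sqrt 2)" by (simp add: arsinh_real_def)
  also have "\<dots> \<le> sqrt 2" by (rule ln_add_one_self_le_self) simp
  finally show "angle r \<le> sqrt 2" .
qed

text \<open>The logarithm of cosh is 1-Lipschitz. This turns an additive error of the angle into a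
  multiplicative error of a factor \<open>1 + r\<close>.\<close>

lemma cosh_le_exp_mult_cosh: "cosh (x :: real) \<le> exp \<bar>x - y\<bar> * cosh y"
proof -
  have "exp x \<le> exp \<bar>x - y\<bar> * exp y" "exp (- x) \<le> exp \<bar>x - y\<bar> * exp (- y)"
    by (simp_all add: exp_add[symmetric])
  then show ?thesis by (simp add: cosh_field_def field_simps)
qed

lemma one_plus_le_exp_angle:
  assumes "0 \<le> r" "0 \<le> s" "\<bar>angle r - angle s\<bar> \<le> \<eta>"
  shows "1 + r \<le> exp (2 * \<eta>) * (1 + s)"
proof -
  have "cosh (angle r) \<le> exp \<bar>angle r - angle s\<bar> * cosh (angle s)" by (rule cosh_le_exp_mult_cosh)
  also have "\<dots> \<le> exp \<eta> * cosh (angle s)" using assms by (simp add: mult_right_mono)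
  finally have "(cosh (angle r))\<^sup>2 \<le> (exp \<eta> * cosh (angle s))\<^sup>2" by (rule power_mono) simp
  then show ?thesis
    using assms by (simp add: cosh_angle power_mult_distrib exp_double)
qed

section \<open>The computation tree, its truncation and the one-step error bound\<close>

locale adjacency_lists =
  fixes G :: "'a graph" and adj :: "'a \<Rightarrow> 'a list"
  assumes simple: "simple_graph G"
    and set_adj: "v \<in> verts G \<Longrightarrow> set (adj v) = neighbours G v"
begin

text \<open>Nodes of the computation tree are pairs of a set of deleted vertices and a vertex. The
  vertex \<open>v\<close> itself is deleted before its neighbours, so no child returns to
  it.\<close>

definition children :: "'a set \<Rightarrow> 'a \<Rightarrow> ('a set \<times> 'a) set" where
  "children D v = set (removal_steps (insert v D) (adj v))"

text \<open>For a vertex \<open>v\<close> outside \<open>D\<close>, this compares the independent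
  sets containing \<open>v\<close> with those avoiding it, in the graph without
  \<open>D\<close>.\<close>

definition ratio :: "'a set \<Rightarrow> 'a \<Rightarrow> real" where
  "ratio D v = Z_on G (verts G - insert v D - neighbours G v) / Z_on G (verts G - insert v D)"

text \<open>The cut-off value 1 lies in the range \<open>[0, 1]\<close> of the true ratios, which
  bounds the initial error. For a vertex without children it is exact.\<close>

primrec trunc_ratio :: "nat \<Rightarrow> 'a set \<Rightarrow> 'a \<Rightarrow> real" where
  "trunc_ratio 0 D v = 1"
| "trunc_ratio (Suc l) D v = (\<Prod>(D', w)\<in>children D v. 1 / (1 + trunc_ratio l D' w))"

lemma finite_children: "finite (children D v)"
  by (simp add: children_def)

lemma children_memD:
  assumes "(D', w) \<in> children D v" "v \<in> verts G"
  shows "w \<in> neighbours G v" "w \<in> verts G" "insert v D \<subseteq> D'" "w \<notin> D'"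
  using removal_steps_memD[OF assms(1)[unfolded children_def]] set_adj[OF assms(2)]
    neighbours_subset[OF simple, of v] by auto

lemma bij_betw_snd_children:
  assumes "v \<in> verts G"
  shows "bij_betw snd (children D v) (neighbours G v - D)"
proof -
  have "set (adj v) - insert v D = neighbours G v - D"
    using neighbours_subset[OF simple, of v] set_adj[OF assms] by blast
  then show ?thesis
    using bij_betw_snd_removal_steps[of "insert v D" "adj v"] by (simp add: children_def)
qed

lemma card_children: "v \<in> verts G \<Longrightarrow> card (children D v) = card (neighbours G v - D)"
  by (rule bij_betw_same_card[OF bij_betw_snd_children])

lemma ratio_nonneg: "0 \<le> ratio D v"
  by (simp add: ratio_def)

text \<open>By \<open>Z_on_remove\<close> each factor is the quotient of the counts after and before
  one removal, so the product telescopes. It is applied to the neighbours of a vertex and to the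
  whole vertex set.\<close>

lemma Z_on_telescope:
  assumes "set ws \<subseteq> verts G"
  shows "real (Z_on G (verts G - D - set ws)) / Z_on G (verts G - D) =
    (\<Prod>(D', w)\<in>set (removal_steps D ws). 1 / (1 + ratio D' w))"
  using assms
proof (induction ws arbitrary: D)
  case Nil
  then show ?case using Z_on_pos[OF simple, of "verts G - D"] by simp
next
  case (Cons w ws)
  show ?case
  proof (cases "w \<in> D")
    case True
    then have "verts G - D - set (w # ws) = verts G - D - set ws" by auto
    then show ?thesis using Cons True by simp
  next
    case False
    let ?Z = "\<lambda>A. real (Z_on G A)" and ?V = "verts G"
    have pos: "?Z A > 0" for A using Z_on_pos[OF simple] by simp
    have eq: "?V - D - {w} = ?V - insert w D" "?V - D - set (w # ws) = ?V - insert w D - set ws" by auto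
    have "?Z (?V - D) = ?Z (?V - insert w D) + ?Z (?V - insert w D - neighbours G w)"
      using Z_on_remove[OF simple, of w "?V - D"] Cons.prems False by (simp add: eq)
    then have "1 / (1 + ratio D w) = ?Z (?V - insert w D) / ?Z (?V - D)"
      using pos[of "?V - insert w D"] by (simp add: ratio_def field_simps)
    moreover have "(\<Prod>(D', w)\<in>set (removal_steps (insert w D) ws). 1 / (1 + ratio D' w)) =
        ?Z (?V - insert w D - set ws) / ?Z (?V - insert w D)"
      using Cons by simp
    moreover have "(D, w) \<notin> set (removal_steps (insert w D) ws)" by (auto dest: removal_steps_memD)
    ultimately show ?thesis
      using False pos[of "?V - insert w D"] by (simp add: eq del: list.set(2)) simp
  qed
qed

lemma ratio_rec:
  assumes "v \<in> verts G"
  shows "ratio D v = (\<Prod>(D', w)\<in>children D v. 1 / (1 + ratio D' w))"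
proof -
  have "set (adj v) \<subseteq> verts G" using neighbours_subset[OF simple, of v] set_adj[OF assms] by blast
  from Z_on_telescope[OF this, of "insert v D"] show ?thesis
    by (simp add: children_def ratio_def set_adj[OF assms])
qed

lemma ratio_le_1: "v \<in> verts G \<Longrightarrow> ratio D v \<le> 1"
  by (subst ratio_rec, simp) (rule prod_le_1, auto simp: ratio_nonneg add_nonneg_nonneg divide_le_eq_1 add_nonneg_pos intro: add_pos_nonneg)

lemma trunc_ratio_nonneg: "0 \<le> trunc_ratio l D v"
  by (induction l arbitrary: D v) (auto intro!: prod_nonneg)

definition err :: "nat \<Rightarrow> 'a set \<Rightarrow> 'a \<Rightarrow> real" where
  "err l D v = (angle (trunc_ratio l D v) - angle (ratio D v))\<^sup>2"

lemma err_0_le: "v \<in> verts G \<Longrightarrow> err 0 D v \<le> 2"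
proof -
  assume v: "v \<in> verts G"
  have "\<bar>angle 1 - angle (ratio D v)\<bar> \<le> sqrt 2"
    using angle_bounds[of 1] angle_bounds[OF ratio_nonneg ratio_le_1[OF v]]
    by (smt (verit) zero_le_one order_refl)
  then show ?thesis by (simp add: err_def abs_le_square_iff[symmetric] sqrt_le_D flip: real_sqrt_abs)
qed

lemma err_no_children:
  assumes "v \<in> verts G" "children D v = {}"
  shows "err l D v = 0"
  using assms by (cases l) (simp_all add: err_def ratio_rec)

lemma err_Suc_le:
  assumes "v \<in> verts G" "contraction_rate (card (children D v)) \<alpha>"
  shows "err (Suc l) D v \<le> \<alpha> * (\<Sum>(D', w)\<in>children D v. err l D' w)"
  using arsinh_prod_contraction[OF finite_children assms(2),
      of "\<lambda>(D', w). angle (trunc_ratio l D' w)" "\<lambda>(D', w). angle (ratio D' w)"]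
    angle_prod[of "children D v" "\<lambda>(D', w). trunc_ratio l D' w"]
    angle_prod[of "children D v" "\<lambda>(D', w). ratio D' w"]
  by (simp add: err_def ratio_rec[OF assms(1)] case_prod_unfold trunc_ratio_nonneg ratio_nonneg)

end

section \<open>Decay of the truncation error\<close>

text \<open>
  The squared error at a vertex with \<open>d\<close> children, whose parent has degree at least \<open>k + 1\<close>, is
  bounded in proportion to this weight. For \<open>d \<ge> 5\<close> the weight may depend on \<open>k\<close> because the degree
  of the parent counts towards the 2-degree; the constants make the induction step work with
  the factor \<open>249 / 250\<close> for both kinds of vertices.
\<close>

definition weight :: "nat \<Rightarrow> nat \<Rightarrow> real" where
  "weight d k = (if d \<le> 4 then real d else 251/50 - real k / 4)"

text \<open>The maximum bounds the weight of any child of a vertex with \<open>d\<close> children.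
  As that vertex has weight \<open>d\<close>, the number of children cancels from the induction
  step.\<close>

lemma weight_small:
  assumes "1 \<le> d" "d \<le> 4"
  shows "\<exists>\<alpha>. contraction_rate d \<alpha> \<and> \<alpha> * max 4 (251/50 - real d / 4) \<le> 249/250"
proof -
  have "d = 1 \<or> d = 2 \<or> d = 3 \<or> d = 4" using assms by auto
  then show ?thesis
    using contraction_rate_1 contraction_rate_2 contraction_rate_3 contraction_rate_4
    by (elim disjE) (force simp: max_def)+
qed

text \<open>\<open>25 - k - d\<close> is the bound on the number of grandchildren from
  \<open>sum_degree_children\<close>. For \<open>d = 5\<close> the coefficients of \<open>k\<close>
  on both sides agree, which explains the slope 1/4 in \<open>weight\<close>.\<close>

lemma weight_large:
  assumes "5 \<le> d"
  shows "\<exists>\<alpha>. contraction_rate d \<alpha> \<and> \<alpha> * (25 - real k - real d) \<le> 249/250 * (251/50 - real k / 4)"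
proof -
  have "d = 5 \<or> d = 6 \<or> d = 7 \<or> 8 \<le> d" using assms by auto
  then show ?thesis
  proof (elim disjE)
    assume "d = 5" then show ?thesis using contraction_rate_5 by (intro exI[of _ "249/1000"]) simp
  next
    assume "d = 6" then show ?thesis using contraction_rate_6 by (intro exI[of _ "51/200"]) simp
  next
    assume "d = 7" then show ?thesis using contraction_rate_7 by (intro exI[of _ "27/100"]) simp
  next
    assume "8 \<le> d" then show ?thesis using contraction_rate_large[of d] by (intro exI[of _ "29/100"]) simp
  qed
qed

locale sparse_adjacency_lists = adjacency_lists +
  assumes two_degree_le: "v \<in> verts G \<Longrightarrow> 6 \<le> degree G v \<Longrightarrow> two_degree G v \<le> 26"
begin

text \<open>Every neighbour has degree at least 1, so the degree is at most the 2-degree.\<close>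

lemma degree_le: 
  assumes "v \<in> verts G"
  shows "degree G v \<le> 26"
proof (cases "6 \<le> degree G v")
  case True
  have "degree G v = (\<Sum>w\<in>neighbours G v. 1)" by (simp add: degree_def)
  also have "\<dots> \<le> two_degree G v"
    unfolding two_degree_def by (rule sum_mono) (use degree_pos[OF simple] in force)
  finally show ?thesis using two_degree_le[OF assms True] by simp
qed simp

lemma card_children_less_degree:
  assumes "v \<in> verts G" "p \<in> neighbours G v" "p \<in> D"
  shows "card (children D v) < degree G v"
  unfolding card_children[OF assms(1)] degree_def
  by (rule psubset_card_mono) (use assms finite_neighbours[OF simple] in auto)

text \<open>Five children and the removed parent \<open>p\<close> make the degree at least 6, so the
  2-degree is at most 26. It includes at least \<open>k + 1\<close> from \<open>p\<close>, and each
  child contributes 1 beyond its term in the sum.\<close>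

lemma sum_degree_children:
  assumes v: "v \<in> verts G" and p: "p \<in> neighbours G v" "p \<in> D" "k < degree G p"
    and d: "5 \<le> card (children D v)"
  shows "k + card (children D v) + (\<Sum>(D', w)\<in>children D v. degree G w - 1) \<le> 25"
proof -
  have fin: "finite (neighbours G v)" by (rule finite_neighbours[OF simple])
  have "(\<Sum>(D', w)\<in>children D v. degree G w - 1) = (\<Sum>c\<in>children D v. degree G (snd c) - 1)"
    by (simp add: case_prod_unfold)
  also have "\<dots> = (\<Sum>w\<in>neighbours G v - D. degree G w - 1)"
    by (rule sum.reindex_bij_betw[OF bij_betw_snd_children[OF v]])
  also have "\<dots> + card (children D v) = (\<Sum>w\<in>neighbours G v - D. (degree G w - 1) + 1)"
    unfolding card_children[OF v] sum.distrib by simp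
  also have "\<dots> = (\<Sum>w\<in>neighbours G v - D. degree G w)"
    by (rule sum.cong) (use degree_pos[OF simple] in force)+
  also have "\<dots> + degree G p = (\<Sum>w\<in>insert p (neighbours G v - D). degree G w)"
    using fin p by simp
  also have "\<dots> \<le> two_degree G v"
    unfolding two_degree_def by (rule sum_mono2) (use fin p in auto)
  also have "\<dots> \<le> 26"
    using two_degree_le[OF v] card_children_less_degree[OF v p(1,2)] d by simp
  finally show ?thesis using p by simp
qed

text \<open>In the induction \<open>v\<close> becomes the removed parent of its children, and its
  own number of children, being smaller than its degree, takes the place of
  \<open>k\<close>.\<close>

lemma err_le_weight:
  assumes "v \<in> verts G" "p \<in> neighbours G v" "p \<in> D" "k < degree G p"
  shows "err l D v \<le> 100 * (249/250) ^ l * weight (card (children D v)) k"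
  using assms
proof (induction l arbitrary: v p D k)
  case 0
  define d where "d = card (children D v)"
  show ?case
  proof (cases "d = 0")
    case True
    then show ?thesis
      using err_no_children[of v D 0] 0 finite_children[of D v] by (simp add: d_def weight_def)
  next
    case False
    \<comment> \<open>The extreme case is \<open>d = 5\<close>, \<open>k = 20\<close>, where the
      weight is \<open>251/50 - 5\<close>. The factor 100 lifts this to 2, the bound on the initial
      error.\<close>
    have "weight d k \<ge> 1/50"
    proof (cases "d \<le> 4")
      case True
      then show ?thesis using False by (simp add: weight_def)
    next
      case False
      then have "k + d \<le> 25" using sum_degree_children[OF 0] by (simp add: d_def)
      then have "k \<le> 20" using False by simp
      then show ?thesis using False by (simp add: weight_def)
    qed
    then show ?thesis using err_0_le[OF 0(1), of D] by (simp add: d_def)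
  qed
next
  case (Suc l)
  note v = Suc.prems(1)
  define d where "d = card (children D v)"
  define m where "m = (\<lambda>(D', w). weight (card (children D' w)) d)"
  have d_less: "d < degree G v"
    using card_children_less_degree[OF Suc.prems(1-3)] by (simp add: d_def)
  have child: "err l D' w \<le> 100 * (249/250) ^ l * m (D', w) \<and> card (children D' w) \<le> degree G w - 1"
    if "(D', w) \<in> children D v" for D' w
  proof -
    note c = children_memD[OF that v]
    have *: "w \<in> verts G" "v \<in> neighbours G w" "v \<in> D'"
      using c by (auto simp: neighbours_sym)
    show ?thesis
      using Suc.IH[OF * d_less] card_children_less_degree[OF *] by (simp add: m_def)
  qed
  have step: ?case if rate: "contraction_rate d \<alpha>" and
    le: "\<alpha> * sum m (children D v) \<le> 249/250 * weight d k" for \<alpha>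
  proof -
    have \<alpha>: "\<alpha> > 0" using rate by (simp add: contraction_rate_def)
    have "err (Suc l) D v \<le> \<alpha> * (\<Sum>(D', w)\<in>children D v. err l D' w)"
      using err_Suc_le[OF v] rate by (simp add: d_def)
    also have "\<dots> \<le> \<alpha> * (\<Sum>c\<in>children D v. 100 * (249/250) ^ l * m c)"
      using \<alpha> child by (intro mult_left_mono sum_mono) auto
    also have "\<dots> = 100 * (249/250) ^ l * (\<alpha> * sum m (children D v))"
      by (simp add: sum_distrib_left[symmetric])
    also have "\<dots> \<le> 100 * (249/250) ^ l * (249/250 * weight d k)"
      by (rule mult_left_mono[OF le]) simp
    also have "\<dots> = 100 * (249/250) ^ Suc l * weight d k" by simp
    finally show ?thesis by (simp only: d_def)
  qed
  consider "d = 0" | "1 \<le> d" "d \<le> 4" | "5 \<le> d" by linarith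
  then show ?case
  proof cases
    case 1
    then show ?thesis
      using err_no_children[OF v, of D] finite_children[of D v] by (simp add: d_def weight_def)
  next
    case 2
    obtain \<alpha> where \<alpha>: "contraction_rate d \<alpha>" "\<alpha> * max 4 (251/50 - real d / 4) \<le> 249/250"
      using weight_small[OF 2] by blast
    have "m c \<le> max 4 (251/50 - real d / 4)" for c
      by (auto simp: m_def weight_def split: prod.split)
    then have "sum m (children D v) \<le> real d * max 4 (251/50 - real d / 4)"
      unfolding d_def by (rule sum_bounded_above)
    then have "\<alpha> * sum m (children D v) \<le> \<alpha> * (real d * max 4 (251/50 - real d / 4))"
      using \<alpha> by (simp add: contraction_rate_def)
    also have "\<dots> = real d * (\<alpha> * max 4 (251/50 - real d / 4))" by simp
    also have "\<dots> \<le> real d * (249/250)" by (rule mult_left_mono[OF \<alpha>(2)]) simp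
    finally show ?thesis using 2 by (intro step[OF \<alpha>(1)]) (simp add: weight_def)
  next
    case 3
    obtain \<alpha> where \<alpha>: "contraction_rate d \<alpha>"
      "\<alpha> * (25 - real k - real d) \<le> 249/250 * (251/50 - real k / 4)"
      using weight_large[OF 3] by blast
    have "m c \<le> real (degree G (snd c) - 1)" if c: "c \<in> children D v" for c
    proof -
      obtain D' w where [simp]: "c = (D', w)" by fastforce
      \<comment> \<open>With more than four children the weight is at most
        \<open>251/50 - 5/4\<close>, which is below 5 because \<open>d \<ge> 5\<close>.\<close>
      have "weight (card (children D' w)) d \<le> real (card (children D' w))"
        using 3 by (simp add: weight_def)
      then show ?thesis using child[of D' w] c by (simp add: m_def)
    qed
    then have "sum m (children D v) \<le> (\<Sum>c\<in>children D v. real (degree G (snd c) - 1))"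
      by (rule sum_mono)
    also have "\<dots> = real (\<Sum>(D', w)\<in>children D v. degree G w - 1)"
      by (simp add: case_prod_unfold)
    also have "\<dots> \<le> 25 - real k - real d"
      using sum_degree_children[OF Suc.prems] 3 unfolding d_def by linarith
    finally have "\<alpha> * sum m (children D v) \<le> \<alpha> * (25 - real k - real d)"
      using \<alpha> by (simp add: contraction_rate_def)
    then show ?thesis using \<alpha> 3 by (intro step[OF \<alpha>(1)]) (simp add: weight_def)
  qed
qed

text \<open>A vertex at the root need not have a removed neighbour, so one level is unfolded with
  the uniform rate 29/100, at most 26 children and child weights at most 251/50. The constant is
  rounded up to a power of two, which suits the later choice of the depth.\<close>

lemma err_le:
  assumes v: "v \<in> verts G"
  shows "err l D v \<le> 4096 * (249/250) ^ l"
proof (cases l)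
  case 0
  then show ?thesis using err_0_le[OF v, of D] by simp
next
  case (Suc l')
  define d where "d = card (children D v)"
  show ?thesis
  proof (cases "d = 0")
    case True
    then show ?thesis
      using err_no_children[OF v, of D] finite_children[of D v] by (simp add: d_def)
  next
    case False
    have "d \<le> degree G v"
      using finite_neighbours[OF simple] by (simp add: d_def card_children v degree_def card_mono)
    then have d: "real d \<le> 26" using degree_le[OF v] by simp
    have "err l' D' w \<le> 100 * (249/250) ^ l' * (251/50)" if "(D', w) \<in> children D v" for D' w
    proof -
      note c = children_memD[OF that v]
      have "err l' D' w \<le> 100 * (249/250) ^ l' * weight (card (children D' w)) 0"
        by (rule err_le_weight[of w v]) (use c v degree_pos[OF simple, of v w] in \<open>auto simp: neighbours_sym\<close>)
      also have "\<dots> \<le> 100 * (249/250) ^ l' * (251/50)"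
        by (rule mult_left_mono) (simp_all add: weight_def)
      finally show ?thesis .
    qed
    then have "(\<Sum>(D', w)\<in>children D v. err l' D' w) \<le> real d * (100 * (249/250) ^ l' * (251/50))"
      unfolding d_def by (intro sum_bounded_above) auto
    also have "\<dots> \<le> 26 * (100 * (249/250) ^ l' * (251/50))" by (rule mult_right_mono[OF d]) simp
    finally have "err l D v \<le> 29/100 * (26 * (100 * (249/250) ^ l' * (251/50)))"
      using err_Suc_le[OF v contraction_rate_large, of D l'] False Suc by (simp add: d_def)
    also have "\<dots> \<le> 4096 * (249/250) ^ l" using Suc by simp
    finally show ?thesis .
  qed
qed

text \<open>Removing all vertices telescopes to \<open>1 / Z G\<close>. Each of the factors, one per
  vertex, is off by at most \<open>exp (2 * \<eta>)\<close>.\<close>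

lemma Z_approx:
  fixes \<eta> :: real
  assumes vs: "set vs = verts G" and \<eta>: "0 \<le> \<eta>" "4096 * (249/250) ^ l \<le> \<eta>\<^sup>2"
  defines "P \<equiv> (\<Prod>(D, w)\<in>set (removal_steps {} vs). 1 / (1 + trunc_ratio l D w))"
  shows "real (Z G) \<le> exp (2 * \<eta> * card (verts G)) * (1 / P)"
    and "1 / P \<le> exp (2 * \<eta> * card (verts G)) * real (Z G)"
proof -
  let ?S = "set (removal_steps {} vs)"
  have card: "card ?S = card (verts G)"
    using bij_betw_same_card[OF bij_betw_snd_removal_steps[of "{}" vs]] vs by simp
  have P: "1 / P = (\<Prod>c\<in>?S. 1 + trunc_ratio l (fst c) (snd c))"
    by (simp add: P_def case_prod_unfold prod_dividef)
  have "1 / real (Z G) = (\<Prod>c\<in>?S. 1 / (1 + ratio (fst c) (snd c)))"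
    using Z_on_telescope[of vs "{}"] vs Z_on_empty[OF simple]
    by (simp add: case_prod_unfold Z_on_verts)
  then have Z: "real (Z G) = (\<Prod>c\<in>?S. 1 + ratio (fst c) (snd c))"
    by (simp add: prod_dividef)
  have close: "\<bar>angle (trunc_ratio l (fst c) (snd c)) - angle (ratio (fst c) (snd c))\<bar> \<le> \<eta>"
    if "c \<in> ?S" for c
  proof -
    have "snd c \<in> verts G" using removal_steps_memD[of "fst c" "snd c" "{}" vs] that vs by simp
    then have "(angle (trunc_ratio l (fst c) (snd c)) - angle (ratio (fst c) (snd c)))\<^sup>2 \<le> \<eta>\<^sup>2"
      using err_le[of "snd c" l "fst c"] \<eta> by (simp add: err_def)
    then show ?thesis using \<eta> by (simp add: abs_le_square_iff[symmetric])
  qed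
  have e: "exp (2 * \<eta> * card (verts G)) = (\<Prod>c\<in>?S. exp (2 * \<eta>))"
    by (simp add: card exp_of_nat_mult[symmetric] mult.commute)
  show "real (Z G) \<le> exp (2 * \<eta> * card (verts G)) * (1 / P)"
    unfolding P Z e prod.distrib[symmetric]
    using close by (intro prod_mono conjI one_plus_le_exp_angle)
      (auto simp: ratio_nonneg trunc_ratio_nonneg abs_minus_commute add_nonneg_nonneg)
  show "1 / P \<le> exp (2 * \<eta> * card (verts G)) * real (Z G)"
    unfolding P Z e prod.distrib[symmetric]
    using close by (intro prod_mono conjI one_plus_le_exp_angle)
      (auto simp: ratio_nonneg trunc_ratio_nonneg add_nonneg_nonneg)
qed

end

section \<open>The program\<close>

text \<open>The choice is unique because evaluation is deterministic. Treating calls as opaque lets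
  \<open>interp\<close> recurse on the expression alone; recursive calls enter as equations from an
  induction hypothesis.\<close>

definition call :: "expr list \<Rightarrow> nat \<Rightarrow> val list \<Rightarrow> (val \<times> nat) option" where
  "call F f us = (if f < length F \<and> (\<exists>v t. eval F us (F ! f) v t)
     then Some (SOME (v, t). eval F us (F ! f) v t) else None)"

lemma call_eq_Some_iff: "call F f us = Some (v, t) \<longleftrightarrow> f < length F \<and> eval F us (F ! f) v t"
proof -
  have "(SOME (v, t). eval F us (F ! f) v t) = (v, t)" if "eval F us (F ! f) v t" for v t
    using that by (intro some_equality) (auto dest: eval_deterministic(1)[OF that])
  then show ?thesis by (auto simp: call_def)
qed

definition bind_cost :: "(val \<times> nat) option \<Rightarrow> (val \<Rightarrow> nat \<Rightarrow> 'b option) \<Rightarrow> 'b option" where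
  "bind_cost x f = (case x of None \<Rightarrow> None | Some (v, t) \<Rightarrow> f v t)"

lemma bind_cost_Some [simp]: "bind_cost (Some (v, t)) f = f v t"
  by (simp add: bind_cost_def)

lemma bind_cost_eq_Some: "bind_cost x f = Some y \<longleftrightarrow> (\<exists>v t. x = Some (v, t) \<and> f v t = Some y)"
  by (auto simp: bind_cost_def split: option.split)

fun arith_cost :: "arith_op \<Rightarrow> val \<Rightarrow> val \<Rightarrow> nat \<Rightarrow> (val \<times> nat) option" where
  "arith_cost f (Num m) (Num n) t = Some (Num (apply_op f m n), t + num_size m + num_size n + 1)"
| "arith_cost f _ _ t = None"

fun first_cost second_cost :: "val \<Rightarrow> nat \<Rightarrow> (val \<times> nat) option" where
  "first_cost (VPair v w) t = Some (v, t + 1)"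
| "first_cost (Num m) t = None"
| "second_cost (VPair v w) t = Some (w, t + 1)"
| "second_cost (Num m) t = None"

text \<open>
  Evaluation as a function, so that the simplifier can run a program body symbolically once the
  results of its calls are known.
\<close>

fun interp :: "expr list \<Rightarrow> val list \<Rightarrow> expr \<Rightarrow> (val \<times> nat) option"
  and interps :: "expr list \<Rightarrow> val list \<Rightarrow> expr list \<Rightarrow> (val list \<times> nat) option"
where
  "interp F env (Var i) = (if i < length env then Some (env ! i, 1) else None)"
| "interp F env (Const m) = Some (Num m, 1)"
| "interp F env (Arith f e\<^sub>1 e\<^sub>2) =
    bind_cost (interp F env e\<^sub>1) (\<lambda>u t\<^sub>1. bind_cost (interp F env e\<^sub>2) (\<lambda>v t\<^sub>2. arith_cost f u v (t\<^sub>1 + t\<^sub>2)))"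
| "interp F env (MkPair e\<^sub>1 e\<^sub>2) =
    bind_cost (interp F env e\<^sub>1) (\<lambda>u t\<^sub>1. bind_cost (interp F env e\<^sub>2) (\<lambda>v t\<^sub>2. Some (VPair u v, t\<^sub>1 + t\<^sub>2 + 1)))"
| "interp F env (First e) = bind_cost (interp F env e) first_cost"
| "interp F env (Second e) = bind_cost (interp F env e) second_cost"
| "interp F env (Cond b e\<^sub>1 e\<^sub>2) =
    bind_cost (interp F env b) (\<lambda>u t\<^sub>1.
      bind_cost (if u = Num 0 then interp F env e\<^sub>2 else interp F env e\<^sub>1) (\<lambda>v t\<^sub>2. Some (v, t\<^sub>1 + t\<^sub>2 + 1)))"
| "interp F env (Bind e\<^sub>1 e\<^sub>2) =
    bind_cost (interp F env e\<^sub>1) (\<lambda>u t\<^sub>1. bind_cost (interp F (u # env) e\<^sub>2) (\<lambda>v t\<^sub>2. Some (v, t\<^sub>1 + t\<^sub>2 + 1)))"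
| "interp F env (Call f es) =
    (case interps F env es of None \<Rightarrow> None
     | Some (us, t\<^sub>1) \<Rightarrow> bind_cost (call F f us) (\<lambda>v t\<^sub>2. Some (v, t\<^sub>1 + t\<^sub>2 + 1)))"
| "interps F env [] = Some ([], 0)"
| "interps F env (e # es) =
    bind_cost (interp F env e) (\<lambda>v t\<^sub>1.
      case interps F env es of None \<Rightarrow> None | Some (vs, t\<^sub>2) \<Rightarrow> Some (v # vs, t\<^sub>1 + t\<^sub>2))"

lemma arith_cost_eq_Some: "arith_cost f u v t = Some (w, s) \<longleftrightarrow>
    (\<exists>m n. u = Num m \<and> v = Num n \<and> w = Num (apply_op f m n) \<and> s = t + num_size m + num_size n + 1)"
  by (cases u; cases v) auto

lemma first_cost_eq_Some: "first_cost u t = Some (w, s) \<longleftrightarrow> (\<exists>w'. u = VPair w w' \<and> s = t + 1)"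
  and second_cost_eq_Some: "second_cost u t = Some (w, s) \<longleftrightarrow> (\<exists>w'. u = VPair w' w \<and> s = t + 1)"
  by (cases u; auto)+

lemma interp_sound:
  "interp F env e = Some (v, t) \<Longrightarrow> eval F env e v t"
  "interps F env es = Some (vs, s) \<Longrightarrow> evals F env es vs s"
proof (induction F env e and F env es arbitrary: v t and vs s rule: interp_interps.induct)
  case (5 F env e)
  then obtain w s where "eval F env e (VPair v w) s" "t = s + 1"
    by (auto simp: bind_cost_eq_Some first_cost_eq_Some)
  then show ?case by (simp only: eval_evals.First)
next
  case (6 F env e)
  then obtain w s where "eval F env e (VPair w v) s" "t = s + 1"
    by (auto simp: bind_cost_eq_Some second_cost_eq_Some)
  then show ?case by (simp only: eval_evals.Second)
next
  case (7 F env b e\<^sub>1 e\<^sub>2)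
  then obtain u t\<^sub>1 t\<^sub>2 where "interp F env b = Some (u, t\<^sub>1)" "t = t\<^sub>1 + t\<^sub>2 + 1"
    and *: "(if u = Num 0 then interp F env e\<^sub>2 else interp F env e\<^sub>1) = Some (v, t\<^sub>2)"
    by (auto simp: bind_cost_eq_Some)
  have "eval F env b u t\<^sub>1" by (rule 7) fact
  then show ?case
    using 7(2)[of u v t\<^sub>2] 7(3)[of u v t\<^sub>2] * \<open>t = t\<^sub>1 + t\<^sub>2 + 1\<close>
    by (cases "u = Num 0") (auto intro: eval_evals.intros[unfolded One_nat_def add_Suc_right add_0_right])
qed (auto simp: bind_cost_eq_Some arith_cost_eq_Some first_cost_eq_Some second_cost_eq_Some
      call_eq_Some_iff split: if_splits option.splits intro!: eval_evals.intros[unfolded One_nat_def add_Suc_right add_0_right])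

lemma call_eqI: "f < length F \<Longrightarrow> interp F us (F ! f) = Some (v, t) \<Longrightarrow> call F f us = Some (v, t)"
  by (simp add: call_eq_Some_iff interp_sound)

lemma num_size_le: "m \<le> 2 ^ k \<Longrightarrow> num_size m \<le> k + 1"
proof -
  assume "m \<le> 2 ^ k"
  then have "m < 2 ^ (k + 1)" by (rule le_less_trans) simp
  then have "int m < 2 ^ (k + 1)" by (metis of_nat_less_iff of_nat_numeral of_nat_power)
  then have "bitlen (int m) \<le> int (k + 1)" by (simp only: bitlen_le_iff_power nat_int of_nat_0_le_iff simp_thms)
  then show ?thesis by (simp add: num_size_def)
qed

lemma num_size_le_self: "num_size m \<le> m + 1"
  by (rule num_size_le) (simp add: less_imp_le)

text \<open>Computes \<open>trunc_ratio l D w\<close> when the environment starts with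
  \<open>w\<close>, the graph, \<open>l\<close> and \<open>D\<close>. It is named separately so that
  the induction on \<open>l\<close> can be kept apart from the one along the list.\<close>

definition ratio_expr :: expr where
  "ratio_expr =
    Cond (Var 2)
      (Call 6 [Var 1, Arith Sub (Var 2) (Const 1), MkPair (Var 0) (Var 3), Call 5 [Var 1, Var 0]])
      (MkPair (Const 1) (Const 1))"

definition prog :: "expr list" where
  "prog =
    [\<comment> \<open>0: length of a list\<close>
     Cond (Var 0) (Arith Add (Const 1) (Call 0 [Second (Var 0)])) (Const 0),
     \<comment> \<open>1: number of binary digits\<close>
     Cond (Var 0) (Arith Add (Const 1) (Call 1 [Arith Div (Var 0) (Const 2)])) (Const 0),
     \<comment> \<open>2: number of leading zero digits of the numerator\<close>
     Cond (First (First (Var 0))) (Const 0) (Arith Add (Const 1) (Call 2 [Second (Var 0)])),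
     \<comment> \<open>3: the list \<open>n - 1, \<dots>, 0\<close>\<close>
     Cond (Var 0) (Bind (Arith Sub (Var 0) (Const 1)) (MkPair (Var 0) (Call 3 [Var 0]))) (Const 0),
     \<comment> \<open>4: membership in a list\<close>
     Cond (Var 1)
       (Cond (Arith Add (Arith Less (Var 0) (First (Var 1))) (Arith Less (First (Var 1)) (Var 0)))
         (Call 4 [Var 0, Second (Var 1)]) (Const 1))
       (Const 0),
     \<comment> \<open>5: list element by index\<close>
     Cond (Var 1) (Call 5 [Second (Var 0), Arith Sub (Var 1) (Const 1)]) (First (Var 0)),
     \<comment> \<open>6: product of \<open>1 / (1 + trunc_ratio l D' w)\<close> along the removal of a list of vertices;
        arguments: adjacency lists, \<open>l\<close>, removed vertices, vertices to be removed\<close>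
     Cond (Var 3)
       (Bind (First (Var 3))
         (Cond (Call 4 [Var 0, Var 3])
           (Call 6 [Var 1, Var 2, Var 3, Second (Var 4)])
           (Bind
             ratio_expr
             (Bind (Call 6 [Var 2, Var 3, MkPair (Var 1) (Var 4), Second (Var 5)])
               (MkPair
                 (Arith Mul (Second (Var 1)) (First (Var 0)))
                 (Arith Mul (Arith Add (First (Var 1)) (Second (Var 1))) (Second (Var 0))))))))
       (MkPair (Const 1) (Const 1))]"

section \<open>Correctness and cost of the functions of the program\<close>

lemma length_prog: "length prog = 7"
  by (simp add: prog_def)

lemmas call_progI = call_eqI[where F = prog, unfolded length_prog]

lemmas prog_nth = prog_def[THEN arg_cong, of "\<lambda>F. F ! i" for i]

lemma call_length:
  "\<exists>t \<le> (length xs + 20) * (length xs + 1). call prog 0 [list_val xs] = Some (Num (length xs), t)"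
proof (induction xs)
  case Nil
  show ?case by (rule exI[of _ 3], simp, rule call_progI) (simp_all add: prog_nth)
next
  case (Cons x xs)
  then obtain t where t: "t \<le> (length xs + 20) * (length xs + 1)"
    "call prog 0 [list_val xs] = Some (Num (length xs), t)" by blast
  show ?case
  proof (intro exI conjI)
    show "call prog 0 [list_val (x # xs)] = Some (Num (length (x # xs)), t + num_size 1 + num_size (length xs) + 7)"
      by (rule call_progI) (simp_all add: prog_nth t)
    show "t + num_size 1 + num_size (length xs) + 7 \<le> (length (x # xs) + 20) * (length (x # xs) + 1)"
      using t(1) num_size_le_self[of 1] num_size_le_self[of "length xs"] by (simp add: algebra_simps)
  qed
qed

text \<open>The lower bound on \<open>2 ^ s\<close> serves the accuracy, the upper bound the running
  time; the maximum with 1 covers \<open>m = 0\<close>.\<close>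

lemma call_digits:
  "\<exists>s. m < 2 ^ s \<and> 2 ^ s \<le> max 1 (2 * m) \<and>
     (\<exists>t \<le> (3 * m + 40) * (m + 1). call prog 1 [Num m] = Some (Num s, t))"
proof (induction m rule: less_induct)
  case (less m)
  show ?case
  proof (cases "m = 0")
    case True
    have "call prog 1 [Num 0] = Some (Num 0, 3)" by (rule call_progI) (simp_all add: prog_nth)
    then show ?thesis using True by (intro exI[of _ 0]) auto
  next
    case False
    then obtain s t where s: "m div 2 < 2 ^ s" "2 ^ s \<le> max 1 (2 * (m div 2))"
      and t: "t \<le> (3 * (m div 2) + 40) * (m div 2 + 1)" "call prog 1 [Num (m div 2)] = Some (Num s, t)"
      using less.IH[of "m div 2"] by auto
    let ?t = "t + num_size m + num_size 2 + num_size 1 + num_size s + 8"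
    have "call prog 1 [Num m] = Some (Num (s + 1), ?t)"
      by (rule call_progI) (use False t in \<open>simp_all add: prog_nth\<close>)
    moreover have "?t \<le> (3 * m + 40) * (m + 1)"
    proof -
      have "s \<le> m" using s(2) less_exp[of s] False by linarith
      moreover have "(3 * (m div 2) + 40) * (m div 2 + 1) \<le> (3 * m + 40) * m"
        using False by (intro mult_mono) auto
      ultimately show ?thesis
        using t(1) num_size_le_self[of m] num_size_le_self[of 2] num_size_le_self[of 1] num_size_le_self[of s]
        by (simp add: algebra_simps)
    qed
    moreover have "m < 2 ^ (s + 1)" "2 ^ (s + 1) \<le> max 1 (2 * m)" using s False by (auto simp: max_def split: if_splits)
    ultimately show ?thesis by blast
  qed
qed

text \<open>Scanning stops at the leading digit 1 of \<open>p\<close>, so the time depends on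
  \<open>s\<close> and not on \<open>L\<close>, while \<open>2 ^ s\<close> determines
  \<open>2 ^ L / p\<close> up to a factor of two.\<close>

lemma call_leading_zeros:
  fixes p q :: int
  assumes "0 < p" "p < 2 ^ L"
  shows "\<exists>s. 2 ^ L \<le> 2 ^ (s + 1) * p \<and> 2 ^ s * p < 2 ^ L \<and> (\<exists>t \<le> (s + 20) * (s + 1).
    call prog 2 [list_val (map (\<lambda>i. VPair (Num (of_bool (bit p i))) (Num (of_bool (bit q i)))) (rev [0..<L]))]
      = Some (Num s, t))"
  using assms
proof (induction L)
  case 0
  then show ?case by simp
next
  case (Suc L)
  have bit: "bit p L \<longleftrightarrow> 2 ^ L \<le> p"
  proof
    assume "bit p L"
    then have "odd (p div 2 ^ L)" by (simp add: bit_iff_odd)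
    then have "p div 2 ^ L \<noteq> 0" by auto
    then show "2 ^ L \<le> p" using Suc.prems by (metis div_pos_pos_trivial less_imp_le not_less)
  next
    assume "2 ^ L \<le> p"
    then have "p div 2 ^ L = 1"
      using Suc.prems by (intro int_div_pos_eq[of _ _ _ "p - 2 ^ L"]) auto
    then show "bit p L" by (simp add: bit_iff_odd)
  qed
  show ?case
  proof (cases "bit p L")
    case True
    have "call prog 2 [list_val (map (\<lambda>i. VPair (Num (of_bool (bit p i))) (Num (of_bool (bit q i)))) (rev [0..<Suc L]))]
      = Some (Num 0, 5)"
      by (rule call_progI) (use True in \<open>simp_all add: prog_nth\<close>)
    then show ?thesis using True bit Suc.prems by (intro exI[of _ 0]) auto
  next
    case False
    then have "p < 2 ^ L" using bit by simp
    then obtain s t where s: "2 ^ L \<le> 2 ^ (s + 1) * p" "2 ^ s * p < 2 ^ L" and t: "t \<le> (s + 20) * (s + 1)"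
      "call prog 2 [list_val (map (\<lambda>i. VPair (Num (of_bool (bit p i))) (Num (of_bool (bit q i)))) (rev [0..<L]))]
        = Some (Num s, t)"
      using Suc by blast
    let ?t = "t + num_size 1 + num_size s + 9"
    have "call prog 2 [list_val (map (\<lambda>i. VPair (Num (of_bool (bit p i))) (Num (of_bool (bit q i)))) (rev [0..<Suc L]))]
      = Some (Num (s + 1), ?t)"
      by (rule call_progI) (use False t in \<open>simp_all add: prog_nth\<close>)
    moreover have "?t \<le> (s + 1 + 20) * (s + 1 + 1)"
      using t(1) num_size_le_self[of 1] num_size_le_self[of s] by (simp add: algebra_simps)
    moreover have "2 ^ Suc L \<le> 2 ^ (s + 1 + 1) * p" "2 ^ (s + 1) * p < 2 ^ Suc L" using s by (simp_all add: mult_ac)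
    ultimately show ?thesis by blast
  qed
qed

lemma call_enumerate:
  "\<exists>t \<le> (n + 20) * (n + 1). call prog 3 [Num n] = Some (list_val (map Num (rev [0..<n])), t)"
proof (induction n)
  case 0
  show ?case by (rule exI[of _ 3], simp, rule call_progI) (simp_all add: prog_nth)
next
  case (Suc n)
  then obtain t where t: "t \<le> (n + 20) * (n + 1)"
    "call prog 3 [Num n] = Some (list_val (map Num (rev [0..<n])), t)" by blast
  show ?case
  proof (intro exI conjI)
    show "call prog 3 [Num (Suc n)] =
        Some (list_val (map Num (rev [0..<Suc n])), t + num_size (Suc n) + num_size 1 + 10)"
      by (rule call_progI) (simp_all add: prog_nth t)
    show "t + num_size (Suc n) + num_size 1 + 10 \<le> (Suc n + 20) * (Suc n + 1)"
      using t(1) num_size_le_self[of 1] num_size_le_self[of "Suc n"] by (simp add: algebra_simps)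
  qed
qed

lemma call_member:
  assumes "x < n" "set D \<subseteq> {..<n}"
  shows "\<exists>t \<le> (4 * n + 40) * (length D + 1).
    call prog 4 [Num x, list_val (map Num D)] = Some (Num (of_bool (x \<in> set D)), t)"
  using assms(2)
proof (induction D)
  case Nil
  have "call prog 4 [Num x, Num 0] = Some (Num 0, 3)" by (rule call_progI) (simp_all add: prog_nth)
  then show ?case by simp
next
  case (Cons y D)
  then obtain t where t: "t \<le> (4 * n + 40) * (length D + 1)"
    "call prog 4 [Num x, list_val (map Num D)] = Some (Num (of_bool (x \<in> set D)), t)" by auto
  define c where "c = 2 * num_size x + 2 * num_size y + num_size (of_bool (x < y)) + num_size (of_bool (y < x))"
  have c: "c \<le> 4 * n + 4"
    using Cons.prems assms(1) num_size_le_self[of x] num_size_le_self[of y]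
      num_size_le_self[of 0] num_size_le_self[of 1]
    by (simp add: c_def split: if_splits)
  show ?case
  proof (cases "x = y")
    case True
    have "call prog 4 [Num x, list_val (map Num (y # D))] = Some (Num 1, c + 13)"
      by (rule call_progI) (simp_all add: prog_nth True c_def)
    then show ?thesis using c True by (intro exI[of _ "c + 13"]) (auto simp: algebra_simps)
  next
    case False
    have "call prog 4 [Num x, list_val (map Num (y # D))] = Some (Num (of_bool (x \<in> set D)), c + 16 + t)"
      by (rule call_progI) (use False t in \<open>auto simp: prog_nth c_def\<close>)
    then show ?thesis using c t False by (intro exI[of _ "c + 16 + t"]) (auto simp: algebra_simps)
  qed
qed

lemma call_nth:
  "i < length xs \<Longrightarrow> \<exists>t \<le> (i + 20) * (i + 1). call prog 5 [list_val xs, Num i] = Some (xs ! i, t)"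
proof (induction i arbitrary: xs)
  case 0
  then obtain x ys where "xs = x # ys" by (cases xs) auto
  then have "call prog 5 [list_val xs, Num 0] = Some (xs ! 0, 4)"
    by (intro call_progI) (simp_all add: prog_nth)
  then show ?case by auto
next
  case (Suc i)
  then obtain x ys where xs: "xs = x # ys" "i < length ys" by (cases xs) auto
  obtain t where t: "t \<le> (i + 20) * (i + 1)" "call prog 5 [list_val ys, Num i] = Some (ys ! i, t)"
    using Suc.IH[OF xs(2)] by blast
  have "call prog 5 [list_val xs, Num (Suc i)] = Some (xs ! Suc i, t + num_size (Suc i) + num_size 1 + 8)"
    by (rule call_progI) (simp_all add: prog_nth t xs)
  moreover have "t + num_size (Suc i) + num_size 1 + 8 \<le> (Suc i + 20) * (Suc i + 1)"
    using t(1) num_size_le_self[of 1] num_size_le_self[of "Suc i"] by (simp add: algebra_simps)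
  ultimately show ?case by blast
qed

text \<open>An outer induction on the depth handles \<open>ratio_expr\<close>, an inner one on
  \<open>ws\<close> the product. \<open>W\<close> bounds the local work of a step for all depths up
  to \<open>m\<close>, including arithmetic on the largest numbers. There are at most 26 children;
  the base 27 absorbs the lower-order terms in both the time and the digit lengths.\<close>

lemma call_removal_product:
  fixes G :: "nat graph" and adj :: "nat \<Rightarrow> nat list" and n m :: nat
  assumes adj: "adjacency_lists G adj" and V: "verts G = {..<n}"
    and len: "\<And>v. v < n \<Longrightarrow> length (adj v) \<le> 26" "\<And>v. v < n \<Longrightarrow> length (adj v) \<le> n"
  defines "g \<equiv> list_val (map (\<lambda>v. list_val (map Num (adj v))) [0..<n])"
    and "W \<equiv> 6 * (2 * 27 ^ m * n + 1) + m + (4 * n + 40) * (n + 1) + (n + 20) * (n + 1) + 100"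
  assumes "l \<le> m" "set ws \<subseteq> {..<n}" "length ws \<le> n" "set D \<subseteq> {..<n}" "distinct D"
  shows "\<exists>a b t. call prog 6 [g, Num l, list_val (map Num D), list_val (map Num ws)]
      = Some (VPair (Num a) (Num b), t) \<and> 0 < a \<and> 0 < b
    \<and> a \<le> 2 ^ (2 * 27 ^ l * length ws) \<and> b \<le> 2 ^ (2 * 27 ^ l * length ws)
    \<and> real a / real b =
        (\<Prod>(D', w)\<in>set (removal_steps (set D) ws). 1 / (1 + adjacency_lists.trunc_ratio adj l D' w))
    \<and> t \<le> W * (3 * 27 ^ l * length ws + 1)"
  using assms(7-)
proof (induction l arbitrary: ws D)
  interpret adjacency_lists G adj by (rule adj)
  let ?P = "\<lambda>l ws D. \<exists>a b t. call prog 6 [g, Num l, list_val (map Num D), list_val (map Num ws)]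
      = Some (VPair (Num a) (Num b), t) \<and> 0 < a \<and> 0 < b
    \<and> a \<le> 2 ^ (2 * 27 ^ l * length ws) \<and> b \<le> 2 ^ (2 * 27 ^ l * length ws)
    \<and> real a / real b =
        (\<Prod>(D', w)\<in>set (removal_steps (set D) ws). 1 / (1 + trunc_ratio l D' w))
    \<and> t \<le> W * (3 * 27 ^ l * length ws + 1)"
  \<comment> \<open>The reserve \<open>W\<close> in the time bound pays for the list step in which
    \<open>ratio_expr\<close> is evaluated.\<close>
  let ?R = "\<lambda>l w D. \<forall>x. \<exists>a b t. interp prog [Num w, g, Num l, list_val (map Num D), x] ratio_expr
      = Some (VPair (Num a) (Num b), t) \<and> 0 < a \<and> 0 < b
    \<and> a + b \<le> 2 ^ (2 * 27 ^ l) \<and> real a / real b = trunc_ratio l (set D) w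
    \<and> t + W \<le> W * (3 * 27 ^ l)"
  have step: "?P l ws D" if l: "l \<le> m"
    and R: "\<And>w D. w < n \<Longrightarrow> set D \<subseteq> {..<n} \<Longrightarrow> distinct D \<Longrightarrow> w \<notin> set D \<Longrightarrow> ?R l w D"
    and ws: "set ws \<subseteq> {..<n}" "length ws \<le> n" and D: "set D \<subseteq> {..<n}" "distinct D" for l ws D
    using ws D
  proof (induction ws arbitrary: D)
    case Nil
    have "call prog 6 [g, Num l, list_val (map Num D), Num 0] = Some (VPair (Num 1) (Num 1), 5)"
      by (rule call_progI) (simp_all add: prog_nth)
    then show ?case by (auto simp: W_def)
  next
    case (Cons w ws)
    have w: "w < n" and ws: "set ws \<subseteq> {..<n}" "length ws \<le> n" using Cons.prems by auto
    have "length D \<le> n"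
      using Cons.prems(3,4) by (metis card_lessThan card_mono distinct_card finite_lessThan)
    moreover obtain tm where tm: "tm \<le> (4 * n + 40) * (length D + 1)"
      "call prog 4 [Num w, list_val (map Num D)] = Some (Num (of_bool (w \<in> set D)), tm)"
      using call_member[OF w Cons.prems(3)] by blast
    ultimately have tm_le: "tm \<le> (4 * n + 40) * (n + 1)"
      by (meson add_le_mono1 le_trans mult_le_mono2)
    show ?case
    proof (cases "w \<in> set D")
      case True
      obtain a b t where t: "call prog 6 [g, Num l, list_val (map Num D), list_val (map Num ws)]
          = Some (VPair (Num a) (Num b), t)" "0 < a" "0 < b"
        "a \<le> 2 ^ (2 * 27 ^ l * length ws)" "b \<le> 2 ^ (2 * 27 ^ l * length ws)"
        "real a / real b = (\<Prod>(D', w)\<in>set (removal_steps (set D) ws). 1 / (1 + trunc_ratio l D' w))"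
        "t \<le> W * (3 * 27 ^ l * length ws + 1)"
        using Cons.IH[OF ws Cons.prems(3,4)] by blast
      have "call prog 6 [g, Num l, list_val (map Num D), list_val (map Num (w # ws))]
          = Some (VPair (Num a) (Num b), t + tm + 15)"
        by (rule call_progI) (use True tm t in \<open>simp_all add: prog_nth\<close>)
      moreover have "t + tm + 15 \<le> W * (3 * 27 ^ l * length (w # ws) + 1)"
      proof -
        have "tm + 15 \<le> W" using tm_le by (simp add: W_def)
        also have "W * 1 \<le> W * (3 * 27 ^ l)" by (rule mult_le_mono2) simp
        finally show ?thesis using t(7) by (simp add: algebra_simps)
      qed
      moreover have "(2::nat) ^ (2 * 27 ^ l * length ws) \<le> 2 ^ (2 * 27 ^ l * length (w # ws))"
        by (rule power_increasing) auto
      ultimately show ?thesis using t(2-6) True by (intro exI[of _ a] exI[of _ b] exI[of _ "t + tm + 15"]) (auto intro: le_trans)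
    next
      case False
      obtain a b t where r: "interp prog [Num w, g, Num l, list_val (map Num D), list_val (map Num (w # ws))] ratio_expr
          = Some (VPair (Num a) (Num b), t)" "0 < a" "0 < b" "a + b \<le> 2 ^ (2 * 27 ^ l)"
        "real a / real b = trunc_ratio l (set D) w" "t + W \<le> W * (3 * 27 ^ l)"
        using R[OF w Cons.prems(3,4) False] by blast
      have "set (w # D) \<subseteq> {..<n}" "distinct (w # D)" using w Cons.prems(3,4) False by auto
      then obtain c d s where s: "call prog 6 [g, Num l, list_val (map Num (w # D)), list_val (map Num ws)]
          = Some (VPair (Num c) (Num d), s)" "0 < c" "0 < d"
        "c \<le> 2 ^ (2 * 27 ^ l * length ws)" "d \<le> 2 ^ (2 * 27 ^ l * length ws)"
        "real c / real d = (\<Prod>(D', w)\<in>set (removal_steps (set (w # D)) ws). 1 / (1 + trunc_ratio l D' w))"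
        "s \<le> W * (3 * 27 ^ l * length ws + 1)"
        using Cons.IH[OF ws] by blast
      define u where "u = num_size b + num_size c + num_size a + num_size b + num_size (a + b) + num_size d"
      have call: "call prog 6 [g, Num l, list_val (map Num D), list_val (map Num (w # ws))]
          = Some (VPair (Num (b * c)) (Num ((a + b) * d)), t + s + tm + u + 33)"
        by (rule call_progI) (use False tm r s in \<open>simp_all add: prog_nth u_def\<close>)
      have K: "2 * 27 ^ l * k \<le> 2 * 27 ^ m * n" if "k \<le> n" for k :: nat
        using l that by (intro mult_le_mono power_increasing) auto
      have "num_size x \<le> 2 * 27 ^ m * n + 1" if "x \<le> 2 ^ (2 * 27 ^ l * k)" "k \<le> n" for x k
        using num_size_le[OF that(1)] K[OF that(2)] by linarith
      note ns = this[of _ 1] this[of _ "length ws"]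
      have "u \<le> 6 * (2 * 27 ^ m * n + 1)"
        using ns(1)[of a] ns(1)[of b] ns(1)[of "a + b"] ns(2)[of c] ns(2)[of d] r(4) s(4,5) w ws(2)
        unfolding u_def by simp
      then have "tm + u + 33 \<le> W" using tm_le by (simp add: W_def)
      then have time: "t + s + tm + u + 33 \<le> W * (3 * 27 ^ l * length (w # ws) + 1)"
        using r(6) s(7) by (simp add: algebra_simps)
      have pow: "(2::nat) ^ (2 * 27 ^ l) * 2 ^ (2 * 27 ^ l * length ws) = 2 ^ (2 * 27 ^ l * length (w # ws))"
        by (simp add: power_add[symmetric])
      have size: "b * c \<le> 2 ^ (2 * 27 ^ l * length (w # ws))" "(a + b) * d \<le> 2 ^ (2 * 27 ^ l * length (w # ws))"
        unfolding pow[symmetric] using r(4) s(4,5) by (intro mult_le_mono; simp)+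
      \<comment> \<open>At all later steps \<open>w\<close> is already removed, so this pair is new
        and its factor splits off the product over the set.\<close>
      have "(set D, w) \<notin> set (removal_steps (insert w (set D)) ws)" by (auto dest: removal_steps_memD)
      then have "(\<Prod>(D', w)\<in>set (removal_steps (set D) (w # ws)). 1 / (1 + trunc_ratio l D' w)) =
          1 / (1 + real a / real b) * (real c / real d)"
        using False s(6) r(5) by simp
      also have "\<dots> = real (b * c) / real ((a + b) * d)"
        using r(2,3) s(2,3) by (simp add: field_simps)
      finally show ?thesis
        using call time size r(2,3) s(2,3) by (intro exI[of _ "b * c"] exI[of _ "(a + b) * d"] exI[of _ "t + s + tm + u + 33"]) auto
    qed
  qed
  have W: "W \<ge> 100" by (simp add: W_def)
  {
    case 0
    have "?R 0 w D" for w D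
    proof
      fix x
      have "interp prog [Num w, g, Num 0, list_val (map Num D), x] ratio_expr = Some (VPair (Num 1) (Num 1), 5)"
        by (simp add: ratio_expr_def)
      then show "\<exists>a b t. interp prog [Num w, g, Num 0, list_val (map Num D), x] ratio_expr
          = Some (VPair (Num a) (Num b), t) \<and> 0 < a \<and> 0 < b
        \<and> a + b \<le> 2 ^ (2 * 27 ^ 0) \<and> real a / real b = trunc_ratio 0 (set D) w
        \<and> t + W \<le> W * (3 * 27 ^ 0)"
        using W by (intro exI[of _ 1] exI[of _ 1] exI[of _ 5]) simp
    qed
    then show ?case using step[of 0] 0 by blast
  next
    case (Suc l)
    have "?R (Suc l) w D" if w: "w < n" and D: "set D \<subseteq> {..<n}" "distinct D" "w \<notin> set D" for w D
    proof
      fix x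
      have "set (adj w) \<subseteq> {..<n}"
        using neighbours_subset[OF simple, of w] set_adj[of w] w V by auto
      moreover have "set (w # D) \<subseteq> {..<n}" "distinct (w # D)" using w D by auto
      ultimately obtain a b t where t: "call prog 6 [g, Num l, list_val (map Num (w # D)), list_val (map Num (adj w))]
          = Some (VPair (Num a) (Num b), t)" "0 < a" "0 < b"
        "a \<le> 2 ^ (2 * 27 ^ l * length (adj w))" "b \<le> 2 ^ (2 * 27 ^ l * length (adj w))"
        "real a / real b = (\<Prod>(D', w)\<in>set (removal_steps (set (w # D)) (adj w)). 1 / (1 + trunc_ratio l D' w))"
        "t \<le> W * (3 * 27 ^ l * length (adj w) + 1)"
        using Suc.IH[of "adj w" "w # D"] len(2)[OF w] Suc.prems(1) by auto
      obtain tn where tn: "tn \<le> (w + 20) * (w + 1)" "call prog 5 [g, Num w] = Some (list_val (map Num (adj w)), tn)"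
        using call_nth[of w "map (\<lambda>v. list_val (map Num (adj v))) [0..<n]"] w unfolding g_def by auto
      define u where "u = num_size (Suc l) + num_size 1"
      have interp: "interp prog [Num w, g, Num (Suc l), list_val (map Num D), x] ratio_expr
          = Some (VPair (Num a) (Num b), t + tn + u + 13)"
        using t(1) tn(2) by (simp add: ratio_expr_def u_def)
      have "(w + 20) * (w + 1) \<le> (n + 20) * (n + 1)" using w by (intro mult_le_mono) auto
      moreover have "u \<le> m + 3"
        using num_size_le_self[of "Suc l"] num_size_le_self[of 1] Suc.prems(1) by (simp add: u_def)
      ultimately have "tn + u + 13 \<le> W" using tn(1) by (simp add: W_def)
      moreover have "t \<le> W * (78 * 27 ^ l + 1)"
      proof -
        have "3 * 27 ^ l * length (adj w) + 1 \<le> 78 * 27 ^ l + 1"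
          using mult_le_mono2[OF len(1)[OF w], of "3 * 27 ^ l"] by simp
        then show ?thesis using t(7) mult_le_mono2 le_trans by blast
      qed
      moreover have "W * (78 * 27 ^ l + 1) + W + W \<le> W * (3 * 27 ^ Suc l)"
      proof -
        \<comment> \<open>78 is \<open>3 * 26\<close>. Passing from 26 to 27 leaves
          \<open>3 * 27 ^ l\<close>, which covers the additive constant of the list, the local work
          and the reserve.\<close>
        have "(78 * 27 ^ l + 3 :: nat) \<le> 3 * 27 ^ Suc l" using one_le_power[of "27::nat" l] by simp
        then have "W * (78 * 27 ^ l + 3) \<le> W * (3 * 27 ^ Suc l)" by (rule mult_le_mono2)
        then show ?thesis by (simp add: algebra_simps)
      qed
      ultimately have time: "t + tn + u + 13 + W \<le> W * (3 * 27 ^ Suc l)" by linarith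
      have "a \<le> 2 ^ (52 * 27 ^ l)" "b \<le> 2 ^ (52 * 27 ^ l)"
        using t(4,5) len(1)[OF w] by (auto intro!: power_increasing elim!: le_trans)
      then have "a + b \<le> 2 ^ (52 * 27 ^ l + 1)" by simp
      also have "\<dots> \<le> 2 ^ (2 * 27 ^ Suc l)"
        using one_le_power[of "27::nat" l] by (intro power_increasing) auto
      finally show "\<exists>a b t. interp prog [Num w, g, Num (Suc l), list_val (map Num D), x] ratio_expr
          = Some (VPair (Num a) (Num b), t) \<and> 0 < a \<and> 0 < b
        \<and> a + b \<le> 2 ^ (2 * 27 ^ Suc l) \<and> real a / real b = trunc_ratio (Suc l) (set D) w
        \<and> t + W \<le> W * (3 * 27 ^ Suc l)"
        using interp time t(2,3,6)
        by (intro exI[of _ a] exI[of _ b] exI[of _ "t + tn + u + 13"]) (simp add: children_def)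
    qed
    then show ?case using step[of "Suc l"] Suc.prems by blast
  }
qed

section \<open>The main program, its accuracy and its polynomial running time\<close>

text \<open>
  The recursion depth is a multiple of 200 because \<open>(249 / 250) ^ 200 \<le> 1 / 2\<close>, so every 200 levels
  halve the squared error.
\<close>

definition main_expr :: expr where
  "main_expr =
    Bind (Call 0 [Var 0])
      (Bind
        (Call 6
          [Var 1,
           Arith Mul (Const 200)
             (Arith Add (Const 18) (Arith Mul (Const 2) (Arith Add (Call 1 [Var 0]) (Call 2 [Var 2])))),
           Const 0,
           Call 3 [Var 0]])
        (MkPair (Second (Var 0)) (First (Var 0))))"

text \<open>The product approximates \<open>1 / Z G\<close>, so the program returns numerator and
  denominator exchanged.\<close>

lemma main_expr_eval:
  fixes G :: "nat graph" and p q :: int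
  defines "n \<equiv> card (verts G)" and "adj \<equiv> \<lambda>v. sorted_list_of_set (neighbours G v)"
  assumes G: "sparse_adjacency_lists G adj" and V: "verts G = {..<n}"
    and p: "0 < p" "p < 2 ^ L"
    and r: "r = list_val (map (\<lambda>i. VPair (Num (of_bool (bit p i))) (Num (of_bool (bit q i)))) (rev [0..<L]))"
  obtains a b t d s where
    "eval prog [graph_val G, r] main_expr (VPair (Num b) (Num a)) t"
    "0 < a" "0 < b"
    "real a / real b =
      (\<Prod>(D, w)\<in>set (removal_steps {} (rev [0..<n])).
        1 / (1 + adjacency_lists.trunc_ratio adj (200 * (18 + 2 * (d + s))) D w))"
    "n < 2 ^ d" "2 ^ d \<le> max 1 (2 * n)"
    "2 ^ L \<le> 2 ^ (s + 1) * p" "2 ^ s * p < 2 ^ L"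
    "t \<le> 2000 * (27 ^ (200 * (18 + 2 * (d + s)))) ^ 2 * (2 ^ (d + s)) ^ 3"
proof -
  interpret sparse_adjacency_lists G adj by (rule G)
  define g where "g = list_val (map (\<lambda>v. list_val (map Num (adj v))) [0..<n])"
  have g: "graph_val G = g" by (simp add: graph_val_def g_def n_def adj_def)
  obtain t\<^sub>0 where t\<^sub>0: "t\<^sub>0 \<le> (n + 20) * (n + 1)" "call prog 0 [g] = Some (Num n, t\<^sub>0)"
    using call_length[of "map (\<lambda>v. list_val (map Num (adj v))) [0..<n]"] by (auto simp: g_def)
  obtain d t\<^sub>1 where d: "n < 2 ^ d" "2 ^ d \<le> max 1 (2 * n)"
    and t\<^sub>1: "t\<^sub>1 \<le> (3 * n + 40) * (n + 1)" "call prog 1 [Num n] = Some (Num d, t\<^sub>1)"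
    using call_digits by blast
  obtain s t\<^sub>2 where s: "2 ^ L \<le> 2 ^ (s + 1) * p" "2 ^ s * p < 2 ^ L"
    and t\<^sub>2: "t\<^sub>2 \<le> (s + 20) * (s + 1)" "call prog 2 [r] = Some (Num s, t\<^sub>2)"
    using call_leading_zeros[OF p, of q] unfolding r by blast
  obtain t\<^sub>3 where t\<^sub>3: "t\<^sub>3 \<le> (n + 20) * (n + 1)"
    "call prog 3 [Num n] = Some (list_val (map Num (rev [0..<n])), t\<^sub>3)"
    using call_enumerate by blast
  define m where "m = 200 * (18 + 2 * (d + s))"
  define W where "W = 6 * (2 * 27 ^ m * n + 1) + m + (4 * n + 40) * (n + 1) + (n + 20) * (n + 1) + 100"
  have nb: "neighbours G v \<subseteq> {..<n}" for v using neighbours_subset[OF simple, of v] V by auto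
  have len: "length (adj v) = degree G v" for v
    by (simp add: adj_def degree_def)
  have len_n: "length (adj v) \<le> n" for v
    using card_mono[OF _ nb, of v] by (simp add: len degree_def)
  have len_26: "v < n \<Longrightarrow> length (adj v) \<le> 26" for v
    using degree_le[of v] V by (simp add: len)
  have all: "set (rev [0..<n]) \<subseteq> {..<n}" "length (rev [0..<n]) \<le> n" by auto
  obtain a b t\<^sub>4 where t\<^sub>4:
    "call prog 6 [g, Num m, Num 0, list_val (map Num (rev [0..<n]))] = Some (VPair (Num a) (Num b), t\<^sub>4)"
    "0 < a" "0 < b"
    "real a / real b = (\<Prod>(D, w)\<in>set (removal_steps {} (rev [0..<n])). 1 / (1 + trunc_ratio m D w))"
    "t\<^sub>4 \<le> W * (3 * 27 ^ m * n + 1)"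
    using call_removal_product[OF adjacency_lists_axioms V len_26 len_n order_refl all, of "[]" m,
        folded g_def W_def]
    by auto
  define u where "u = num_size d + num_size s + num_size 2 + num_size (d + s) + num_size 18
    + num_size (2 * (d + s)) + num_size 200 + num_size (18 + 2 * (d + s))"
  define t where "t = t\<^sub>0 + t\<^sub>1 + t\<^sub>2 + t\<^sub>3 + t\<^sub>4 + u + 25"
  have "interp prog [g, r] main_expr = Some (VPair (Num b) (Num a), t)"
    unfolding main_expr_def t_def
    using t\<^sub>0(2) t\<^sub>1(2) t\<^sub>2(2) t\<^sub>3(2) t\<^sub>4(1)[unfolded m_def] by (simp add: u_def)
  then have "eval prog [graph_val G, r] main_expr (VPair (Num b) (Num a)) t"
    unfolding g by (rule interp_sound)
  moreover have "t \<le> 2000 * (27 ^ m) ^ 2 * (2 ^ (d + s)) ^ 3"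
  proof -
    \<comment> \<open>\<open>X\<close> exceeds \<open>n\<close>, \<open>d\<close> and
      \<open>s\<close>, and \<open>K\<close> exceeds \<open>m\<close>, so each cost is bounded by a
      monomial in them. The dominant one, \<open>K * K * (X * X * X)\<close>, comes from function
      6.\<close>
    define X where "X = (2::nat) ^ (d + s)"
    define K where "K = (27::nat) ^ m"
    have "2 ^ d \<le> X" "2 ^ s \<le> X" by (simp_all add: X_def power_add)
    then have n: "n + 1 \<le> X" and "s + 1 \<le> X" "d + 1 \<le> X"
      using d(1) less_exp[of s] less_exp[of d] by linarith+
    have ds: "d + s + 1 \<le> X" using less_exp[of "d + s"] unfolding X_def by linarith
    have X: "1 \<le> X" and K: "m + 1 \<le> K" "1 \<le> K"
      using n less_exp[of m] power_mono[of 2 "27::nat" m] unfolding K_def by linarith+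
    have XX: "X \<le> X * X" "1 \<le> X * X" using X by simp_all
    have sq: "(i * x + j) * (x + 1) \<le> (i + j) * (X * X)" if "x + 1 \<le> X" for x i j :: nat
    proof -
      have "(i * x + j) * (x + 1) \<le> (i * X + j * X) * X"
        using that X by (intro mult_le_mono add_mono) auto
      then show ?thesis by (simp add: algebra_simps)
    qed
    have "t\<^sub>0 \<le> 21 * (X * X)" "t\<^sub>1 \<le> 43 * (X * X)" "t\<^sub>2 \<le> 21 * (X * X)" "t\<^sub>3 \<le> 21 * (X * X)"
      using sq[OF n, of 1 20] sq[OF n, of 3 40] sq[OF \<open>s + 1 \<le> X\<close>, of 1 20] t\<^sub>0 t\<^sub>1 t\<^sub>2 t\<^sub>3 by simp_all
    moreover have "u \<le> 1000 * X"
    proof -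
      have "u \<le> (d + 1) + (s + 1) + (2 + 1) + (d + s + 1) + (18 + 1)
          + (2 * (d + s) + 1) + (200 + 1) + (18 + 2 * (d + s) + 1)"
        unfolding u_def by (intro add_mono num_size_le_self)
      also have "\<dots> \<le> 1000 * X" using ds by simp
      finally show ?thesis .
    qed
    moreover have "t\<^sub>4 \<le> 600 * (K * K * (X * X * X))"
    proof -
      have KX: "K * n + 1 \<le> K * X" using mult_le_mono2[OF n, of K] K by simp
      have KXX: "K * X \<le> K * (X * X)" "X * X \<le> K * (X * X)" "K \<le> K * (X * X)" "1 \<le> K * (X * X)"
        using X K XX by simp_all
      have "W \<le> 200 * (K * (X * X))"
      proof -
        have "W = 12 * (K * n) + 6 + m + (4 * n + 40) * (n + 1) + (n + 20) * (n + 1) + 100"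
          by (simp add: W_def K_def)
        moreover have "(n + 20) * (n + 1) \<le> 21 * (X * X)" using sq[OF n, of 1 20] by simp
        moreover have "(4 * n + 40) * (n + 1) \<le> 44 * (X * X)" using sq[OF n, of 4 40] by simp
        ultimately show ?thesis using KX KXX K(1) by linarith
      qed
      moreover have "3 * K * n + 1 \<le> 3 * (K * X)" using KX by simp
      ultimately have "W * (3 * K * n + 1) \<le> 200 * (K * (X * X)) * (3 * (K * X))" by (rule mult_le_mono)
      then show ?thesis using t\<^sub>4(5) by (simp add: K_def[symmetric] mult_ac)
    qed
    moreover have "X * X \<le> K * K * (X * X * X)" "X \<le> K * K * (X * X * X)" "1 \<le> K * K * (X * X * X)"
      using X K by simp_all
    ultimately have "t \<le> 2000 * (K * K * (X * X * X))" unfolding t_def by linarith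
    then show ?thesis by (simp add: X_def K_def power2_eq_square power3_eq_cube mult_ac)
  qed
  ultimately show ?thesis using that t\<^sub>4 d s by (simp add: m_def)
qed

text \<open>The depth is affine in \<open>e\<close>, so the power of 27 is, up to a constant factor,
  bounded by a fixed power of \<open>2 ^ e\<close>, by \<open>27 \<le> 2 ^ 5\<close>.\<close>

lemma runtime_polynomial:
  "\<exists>c k. \<forall>e. 2000 * (27 ^ (h * (j + 2 * e))) ^ 2 * (2 ^ e) ^ 3 \<le> c * (2 ^ e :: nat) ^ k"
proof (intro exI allI)
  fix e :: nat
  have "(27::nat) ^ (h * (j + 2 * e)) = 27 ^ (h * j) * 27 ^ (2 * h * e)"
    by (simp add: power_add[symmetric] algebra_simps)
  also have "(27::nat) ^ (2 * h * e) \<le> (2 ^ 5) ^ (2 * h * e)" by (rule power_mono) auto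
  also have "\<dots> = (2 ^ e) ^ (10 * h)" by (simp only: power_mult[symmetric]) (simp add: mult_ac)
  finally have "27 ^ (h * (j + 2 * e)) \<le> 27 ^ (h * j) * (2 ^ e :: nat) ^ (10 * h)" by simp
  then have "(27 ^ (h * (j + 2 * e))) ^ 2 \<le> (27 ^ (h * j) * (2 ^ e :: nat) ^ (10 * h)) ^ 2"
    by (rule power_mono) simp
  then have "2000 * (27 ^ (h * (j + 2 * e))) ^ 2 * (2 ^ e) ^ 3
      \<le> 2000 * (27 ^ (h * j) * (2 ^ e :: nat) ^ (10 * h)) ^ 2 * (2 ^ e) ^ 3"
    by (intro mult_le_mono) auto
  also have "\<dots> = 2000 * (27 ^ (h * j)) ^ 2 * (2 ^ e) ^ (20 * h + 3)"
    by (simp add: power_mult_distrib power_mult[symmetric] power_add[symmetric] algebra_simps)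
  finally show "2000 * (27 ^ (h * (j + 2 * e))) ^ 2 * (2 ^ e) ^ 3
      \<le> 2000 * (27 ^ (h * j)) ^ 2 * (2 ^ e :: nat) ^ (20 * h + 3)" .
qed

lemma decay_le: "(249/250 :: real) ^ (200 * k) \<le> 1 / 2 ^ k"
proof -
  have "(249/250 :: real) ^ 200 \<le> 1/2" by (simp add: power_divide)
  then have "((249/250 :: real) ^ 200) ^ k \<le> (1/2) ^ k" by (rule power_mono) simp
  then show ?thesis by (simp only: power_mult power_one_over)
qed

text \<open>Uses \<open>exp (\<epsilon> / 2) \<le> 1 + \<epsilon>\<close> for one side and
  \<open>1 - \<epsilon> \<le> exp (- \<epsilon> / 2)\<close> for the other.\<close>

lemma exp_half_bounds:
  assumes "0 < \<epsilon>" "\<epsilon> < (1::real)" "0 < z" "z \<le> exp (\<epsilon> / 2) * y" "y \<le> exp (\<epsilon> / 2) * z"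
  shows "(1 - \<epsilon>) * z \<le> y" "y \<le> (1 + \<epsilon>) * z"
proof -
  have "exp (\<epsilon> / 2) \<le> 1 + \<epsilon> / 2 + (\<epsilon> / 2)\<^sup>2" using assms by (intro exp_bound) auto
  also have "\<dots> \<le> 1 + \<epsilon>"
  proof -
    have "(\<epsilon> / 2)\<^sup>2 \<le> \<epsilon> / 2" using power_decreasing[of 1 2 "\<epsilon> / 2"] assms by simp
    then show ?thesis by linarith
  qed
  finally have "exp (\<epsilon> / 2) * z \<le> (1 + \<epsilon>) * z" using assms by (intro mult_right_mono) auto
  then show "y \<le> (1 + \<epsilon>) * z" using assms by linarith
  have "(1 - \<epsilon>) * z \<le> exp (- (\<epsilon> / 2)) * z"
    using assms exp_ge_add_one_self[of "- (\<epsilon> / 2)"] by (intro mult_right_mono) linarith+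
  also have "\<dots> \<le> exp (- (\<epsilon> / 2)) * (exp (\<epsilon> / 2) * y)" using assms by (intro mult_left_mono) auto
  also have "\<dots> = y" by (simp add: exp_minus)
  finally show "(1 - \<epsilon>) * z \<le> y" .
qed

lemma main_expr_correct:
  fixes G :: "nat graph" and \<epsilon> :: rat
  assumes sparse: "\<forall>v\<in>verts G. degree G v \<ge> 6 \<longrightarrow> two_degree G v \<le> 26"
    and G: "simple_graph G" "verts G = {..<card (verts G)}" and \<epsilon>: "0 < \<epsilon>" "\<epsilon> < 1"
  obtains a b t e where
    "eval prog [graph_val G, rat_val \<epsilon>] main_expr (VPair (Num b) (Num a)) t" "0 < a"
    "(1 - \<epsilon>) * of_nat (Z G) \<le> of_nat b / of_nat a" "of_nat b / of_nat a \<le> (1 + \<epsilon>) * of_nat (Z G)"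
    "t \<le> 2000 * (27 ^ (200 * (18 + 2 * e))) ^ 2 * (2 ^ e) ^ 3"
    "2 ^ e \<le> 4 * (of_nat (card (verts G)) + 1 / \<epsilon>) ^ 2"
proof -
  define n where "n = card (verts G)"
  define adj where "adj = (\<lambda>v. sorted_list_of_set (neighbours G v))"
  have adj: "sparse_adjacency_lists G (\<lambda>v. sorted_list_of_set (neighbours G v))"
    by unfold_locales (use sparse finite_neighbours[OF G(1)] G(1) in auto)
  interpret sparse_adjacency_lists G adj unfolding adj_def by (rule adj)
  obtain p q where pq: "quotient_of \<epsilon> = (p, q)" by fastforce
  have q: "0 < q" using quotient_of_denom_pos[OF pq] .
  have \<epsilon>_eq: "\<epsilon> = of_int p / of_int q" using quotient_of_div[OF pq] .
  have p: "0 < p" "p < q" using \<epsilon> q by (simp_all add: \<epsilon>_eq zero_less_divide_iff)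
  define L where "L = nat (bitlen q)"
  have "q < 2 ^ L" "2 ^ nat (bitlen q - 1) \<le> q" using bitlen_bounds[OF q] by (simp_all add: L_def)
  moreover have "L = Suc (nat (bitlen q - 1))"
    using q bitlen_nonneg[of q] bitlen_eq_zero_iff[of q] unfolding L_def by linarith
  \<comment> \<open>Comparing \<open>p\<close> with \<open>2 ^ L\<close> in place of
    \<open>q\<close> thus costs at most a factor of two.\<close>
  ultimately have L: "q < 2 ^ L" "2 ^ L \<le> 2 * q" by simp_all
  have pL: "p < 2 ^ L" using p L by simp
  have r: "rat_val \<epsilon> = list_val (map (\<lambda>i. VPair (Num (of_bool (bit p i))) (Num (of_bool (bit q i)))) (rev [0..<L]))"
    by (simp add: rat_val_def pq L_def)
  obtain a b t d s where *:
    "eval prog [graph_val G, rat_val \<epsilon>] main_expr (VPair (Num b) (Num a)) t"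
    "0 < a" "0 < b"
    "real a / real b =
      (\<Prod>(D, w)\<in>set (removal_steps {} (rev [0..<n])). 1 / (1 + trunc_ratio (200 * (18 + 2 * (d + s))) D w))"
    "n < 2 ^ d" "2 ^ d \<le> max 1 (2 * n)"
    "2 ^ L \<le> 2 ^ (s + 1) * p" "2 ^ s * p < 2 ^ L"
    "t \<le> 2000 * (27 ^ (200 * (18 + 2 * (d + s)))) ^ 2 * (2 ^ (d + s)) ^ 3"
    using main_expr_eval[OF adj G(2) p(1) pL r, folded n_def adj_def] .
  define \<epsilon>' where "\<epsilon>' = real_of_rat \<epsilon>"
  have \<epsilon>': "0 < \<epsilon>'" "\<epsilon>' < 1" using \<epsilon> by (simp_all add: \<epsilon>'_def)
  have \<epsilon>'_eq: "\<epsilon>' = real_of_int p / real_of_int q" by (simp add: \<epsilon>'_def \<epsilon>_eq of_rat_divide)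
  have "q \<le> 2 ^ (s + 1) * p" using L *(7) by linarith
  then have "real_of_int q \<le> real_of_int (2 ^ (s + 1) * p)" by (rule of_int_le_iff[THEN iffD2])
  then have s_lower: "1 / 2 ^ (s + 1) \<le> \<epsilon>'" using q by (simp add: \<epsilon>'_eq field_simps)
  define m where "m = 200 * (18 + 2 * (d + s))"
  \<comment> \<open>The depth makes the squared error at most
    \<open>2 ^ 12 / 2 ^ (18 + 2 * (d + s))\<close>, which is the square of this \<eta>. Since
    \<open>n < 2 ^ d\<close>, the total exponent \<open>2 * \<eta> * n\<close> is at most
    \<open>1 / 2 ^ (s + 2)\<close>, hence at most \<epsilon>/2.\<close>
  define \<eta> :: real where "\<eta> = 1 / 2 ^ (3 + d + s)"
  have "4096 * (249/250) ^ m \<le> 4096 * (1 / 2 ^ (18 + 2 * (d + s)) :: real)"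
    unfolding m_def by (intro mult_left_mono decay_le) simp
  also have "(2::real) ^ (18 + 2 * (d + s)) = 2 ^ 12 * (2 ^ (3 + d + s)) ^ 2"
    by (simp only: power_mult[symmetric] power_add[symmetric]) (rule arg_cong[of _ _ "power 2"], simp)
  also have "4096 * (1 / \<dots>) = \<eta>\<^sup>2" by (simp add: \<eta>_def power_divide)
  finally have decay: "4096 * (249/250) ^ m \<le> \<eta>\<^sup>2" .
  have "real n \<le> 2 ^ d" using *(5) by (metis less_imp_le of_nat_le_iff of_nat_numeral of_nat_power)
  then have "2 * \<eta> * real n \<le> 2 * \<eta> * 2 ^ d" by (intro mult_left_mono) (simp_all add: \<eta>_def)
  also have "\<dots> = (1 / 2 ^ (s + 1)) / 2" by (simp add: \<eta>_def power_add)
  also have "\<dots> \<le> \<epsilon>' / 2" using s_lower by simp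
  finally have exp: "exp (2 * \<eta> * real n) \<le> exp (\<epsilon>' / 2)" by simp
  have vs: "set (rev [0..<n]) = verts G" unfolding n_def by (subst G(2)) auto
  have "0 \<le> \<eta>" by (simp add: \<eta>_def)
  note Z = Z_approx[OF vs this decay, folded n_def]
  have inv: "1 / (\<Prod>(D, w)\<in>set (removal_steps {} (rev [0..<n])). 1 / (1 + trunc_ratio m D w)) = real b / real a"
    unfolding m_def *(4)[symmetric] by simp
  have "real (Z G) \<le> exp (2 * \<eta> * real n) * (real b / real a)"
    using Z(1) unfolding inv .
  also have "\<dots> \<le> exp (\<epsilon>' / 2) * (real b / real a)" by (rule mult_right_mono[OF exp]) simp
  finally have Z_le: "real (Z G) \<le> exp (\<epsilon>' / 2) * (real b / real a)" .
  have "real b / real a \<le> exp (2 * \<eta> * real n) * real (Z G)"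
    using Z(2) unfolding inv .
  also have "\<dots> \<le> exp (\<epsilon>' / 2) * real (Z G)" by (rule mult_right_mono[OF exp]) simp
  finally have le_Z: "real b / real a \<le> exp (\<epsilon>' / 2) * real (Z G)" .
  have "0 < real (Z G)" using Z_on_pos[OF G(1), of "verts G"] by (simp add: Z_on_verts)
  note exp_half_bounds[OF \<epsilon>' this Z_le le_Z]
  then have "real_of_rat ((1 - \<epsilon>) * of_nat (Z G)) \<le> real_of_rat (of_nat b / of_nat a)"
    "real_of_rat (of_nat b / of_nat a) \<le> real_of_rat ((1 + \<epsilon>) * of_nat (Z G))"
    by (simp_all add: \<epsilon>'_def of_rat_mult of_rat_diff of_rat_add of_rat_divide)
  then have approx: "(1 - \<epsilon>) * of_nat (Z G) \<le> of_nat b / of_nat a"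
    "of_nat b / of_nat a \<le> (1 + \<epsilon>) * of_nat (Z G)"
    by (simp_all only: of_rat_less_eq)
  \<comment> \<open>As \<epsilon> < 1, \<open>y\<close> is at least 1, which handles the maximum in
    the bound on \<open>2 ^ d\<close> when \<open>n = 0\<close>. Both \<open>2 ^ d\<close> and
    \<open>2 ^ s\<close> are at most \<open>2 * y\<close>.\<close>
  define y :: rat where "y = of_nat n + 1 / \<epsilon>"
  have y: "1 / \<epsilon> \<le> y" "of_nat n \<le> y" "1 \<le> y"
    using \<epsilon> by (simp_all add: y_def add_increasing)
  have "(of_nat (2 ^ d) :: rat) \<le> of_nat (max 1 (2 * n))" using *(6) by (simp only: of_nat_le_iff)
  then have "(2 ^ d :: rat) \<le> max 1 (2 * of_nat n)" by (simp add: of_nat_max)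
  also have "\<dots> \<le> 2 * y" by (rule max.boundedI) (use y in simp_all)
  finally have d_upper: "(2 ^ d :: rat) \<le> 2 * y" .
  have "2 ^ s * p \<le> 2 * q" using L *(8) by linarith
  then have "(of_int (2 ^ s * p) :: rat) \<le> of_int (2 * q)" by (rule of_int_le_iff[THEN iffD2])
  then have "(2 ^ s :: rat) \<le> 2 * (1 / \<epsilon>)" using p by (simp add: \<epsilon>_eq field_simps)
  also have "\<dots> \<le> 2 * y" using y(1) by (rule mult_left_mono) simp
  finally have "(2 ^ (d + s) :: rat) \<le> (2 * y) * (2 * y)"
    unfolding power_add using y by (intro mult_mono d_upper) auto
  also have "\<dots> = 4 * y ^ 2" by (simp add: power2_eq_square)
  finally have "(2 ^ (d + s) :: rat) \<le> 4 * (of_nat n + 1 / \<epsilon>) ^ 2" unfolding y_def .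
  then show ?thesis using that[OF *(1,2) approx *(9)] by (simp add: n_def)
qed

theorem theorem4:
  "has_fptas Z {G. \<forall>v\<in>verts G. degree G v \<ge> 6 \<longrightarrow> two_degree G v \<le> 26}"
proof -
  obtain c k where ck: "\<And>e. 2000 * (27 ^ (200 * (18 + 2 * e))) ^ 2 * (2 ^ e) ^ 3 \<le> c * (2 ^ e :: nat) ^ k"
    using runtime_polynomial[of 200 18] by blast
  have "\<exists>a b t. eval prog [graph_val G, rat_val \<epsilon>] main_expr (VPair (Num a) (Num b)) t \<and> 0 < b
      \<and> (1 - \<epsilon>) * of_nat (Z G) \<le> of_nat a / of_nat b \<and> of_nat a / of_nat b \<le> (1 + \<epsilon>) * of_nat (Z G)
      \<and> of_nat t \<le> of_nat (c * 4 ^ k) * (of_nat (card (verts G)) + 1 / \<epsilon>) ^ (2 * k)"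
    if G: "\<forall>v\<in>verts G. degree G v \<ge> 6 \<longrightarrow> two_degree G v \<le> 26"
      "simple_graph G" "verts G = {..<card (verts G)}" and \<epsilon>: "0 < \<epsilon>" "\<epsilon> < 1" for G and \<epsilon> :: rat
  proof -
    obtain a b t e where *:
      "eval prog [graph_val G, rat_val \<epsilon>] main_expr (VPair (Num b) (Num a)) t" "0 < a"
      "(1 - \<epsilon>) * of_nat (Z G) \<le> of_nat b / of_nat a" "of_nat b / of_nat a \<le> (1 + \<epsilon>) * of_nat (Z G)"
      "t \<le> 2000 * (27 ^ (200 * (18 + 2 * e))) ^ 2 * (2 ^ e) ^ 3"
      "2 ^ e \<le> 4 * (of_nat (card (verts G)) + 1 / \<epsilon>) ^ 2"
      using main_expr_correct[OF G \<epsilon>] .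
    have "t \<le> c * (2 ^ e) ^ k" using *(5) ck le_trans by blast
    then have "(of_nat t :: rat) \<le> of_nat (c * (2 ^ e) ^ k)" by (simp only: of_nat_le_iff)
    also have "\<dots> = of_nat c * (2 ^ e) ^ k" by simp
    also have "\<dots> \<le> of_nat c * (4 * (of_nat (card (verts G)) + 1 / \<epsilon>) ^ 2) ^ k"
      using *(6) by (intro mult_left_mono power_mono) auto
    also have "\<dots> = of_nat (c * 4 ^ k) * (of_nat (card (verts G)) + 1 / \<epsilon>) ^ (2 * k)"
      by (simp add: power_mult_distrib power_mult)
    finally show ?thesis using *(1-4) by blast
  qed
  then show ?thesis unfolding has_fptas_def by blast
qed

end
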